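(* Let $H$ be a finite dimensional Hilbert space, let $B$ be a unital $C^*$-algebra acting on $H$, and let $\mathrm{Tr}$ denote the usual trace on $B(H)$. Let $P\colon B\to B$ be a unital projection map which is trace preserving, i.e. $\mathrm{Tr}(P(a))=\mathrm{Tr}(a)$ for all $a\in B$. Put $A=P(B_{sa})$. Then: (i) $P$ is $(2,2)$-decomposable if and only if $P$ is decomposable. (ii) $P$ is atomic if and only if $A$ is a nonreversible Jordan algebra.
   Context: For a unital $C^*$-algebra $B$, $B_{sa}$ denotes its self-adjoint part. A projection map on $B$ is a positive linear map $P\colon B\to B$ with $P(1)=1$ and $P^2=P$. If $P$ is faithful (which is the case when $P$ is trace preserving), then it is known that $P(B_{sa})$ is a Jordan subalgebra of $B_{sa}$ under the Jordan product $a\circ b=\frac12(ab+ba)$. A Jordan algebra $A\subset B_{sa}$ is reversible if $a_1a_2\cdots a_n+a_na_{n-1}\cdots a_1\in A$ for all $n$ and all $a_1,\dots,a_n\in A$; otherwise it is nonreversible. A linear map $\phi$ between $C^*$-algebras is $k$-positive if $\phi\otimes\iota_k$ is positive, where $\iota_k$ is the identity map on $M_k(\mathbb{C})$; it is $k$-copositive if $\phi\otimes\theta_k$ is positive, where $\theta_k$ is the transpose map on $M_k(\mathbb{C})$. It is completely positive (respectively copositive) if it is $k$-positive (respectively $k$-copositive) for all $k$; equivalently to the latter, it is the composition of a completely positive map and an anti-automorphism. A positive map is decomposable if it is the sum of a completely positive map and a copositive map. It is $(2,2)$-decomposable if it is the sum of a 2-positive map and a 2-copositive map (either summand may be zero).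 A positive map is atomic if it is not $(2,2)$-decomposable. *)

theory Defs
  imports "HOL-Analysis.Analysis"
begin

text \<open>
  Operators on the Hilbert space \<open>\<complex>\<^sup>n\<close> are square complex matrices indexed by a finite type;
  the usual trace is \<^const>\<open>trace\<close>, and \<open>*\<^sub>R\<close> is the real scalar multiplication.
\<close>

subsection \<open>Operators and C*-algebras acting on a finite dimensional Hilbert space\<close>

definition cinner :: "complex^'n \<Rightarrow> complex^'n \<Rightarrow> complex" where
  "cinner x y = (\<Sum>i\<in>UNIV. x $ i * cnj (y $ i))"

definition adj :: "complex^'n^'n \<Rightarrow> complex^'n^'n" where
  "adj a = map_matrix cnj (transpose a)"

definition cscale :: "complex \<Rightarrow> complex^'n^'n \<Rightarrow> complex^'n^'n" where
  "cscale c a = map_matrix (\<lambda>z. c * z) a"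

text \<open>The closedness condition is automatic in finite dimension.\<close>

definition cstar_algebra :: "(complex^'n^'n) set \<Rightarrow> bool" where
  "cstar_algebra B \<longleftrightarrow>
     0 \<in> B \<and>
     (\<forall>a\<in>B. \<forall>b\<in>B. a + b \<in> B) \<and>
     (\<forall>c. \<forall>a\<in>B. cscale c a \<in> B) \<and>
     (\<forall>a\<in>B. \<forall>b\<in>B. a ** b \<in> B) \<and>
     (\<forall>a\<in>B. adj a \<in> B) \<and>
     closed B"

text \<open>The unit of \<open>B\<close> is not required to be the identity operator.\<close>

definition is_unit_of :: "complex^'n^'n \<Rightarrow> (complex^'n^'n) set \<Rightarrow> bool" where
  "is_unit_of e B \<longleftrightarrow> e \<in> B \<and> (\<forall>a\<in>B. e ** a = a \<and> a ** e = a)"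

definition self_adjoint_part :: "(complex^'n^'n) set \<Rightarrow> (complex^'n^'n) set" where
  "self_adjoint_part B = {a \<in> B. adj a = a}"

definition positive_operator :: "complex^'n^'n \<Rightarrow> bool" where
  "positive_operator a \<longleftrightarrow> (\<forall>x. cinner (a *v x) x \<in> \<real>\<^sub>\<ge>\<^sub>0)"

text \<open>
  An element of \<open>B \<otimes> M\<^sub>k(\<complex>)\<close> is a \<open>k \<times> k\<close> array \<open>a\<close> over \<open>B\<close>, standing for the sum of the
  \<open>a i j \<otimes> E\<^sub>i\<^sub>j\<close> with \<open>i, j < k\<close>. It acts on the direct sum of \<open>k\<close> copies of the Hilbert space
  by \<open>(a x)\<^sub>i = \<Sum>\<^sub>j a i j *v x j\<close>; entries with an index \<open>\<ge> k\<close> are irrelevant.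
\<close>

definition mat_over :: "nat \<Rightarrow> (complex^'n^'n) set \<Rightarrow> (nat \<Rightarrow> nat \<Rightarrow> complex^'n^'n) set" where
  "mat_over k B = {a. \<forall>i<k. \<forall>j<k. a i j \<in> B}"

definition positive_block :: "nat \<Rightarrow> (nat \<Rightarrow> nat \<Rightarrow> complex^'n^'n) \<Rightarrow> bool" where
  "positive_block k a \<longleftrightarrow>
     (\<forall>x :: nat \<Rightarrow> complex^'n. (\<Sum>i<k. cinner (\<Sum>j<k. a i j *v x j) (x i)) \<in> \<real>\<^sub>\<ge>\<^sub>0)"


subsection \<open>Linear maps between C*-algebras\<close>

text \<open>Maps are total functions, of which only the values on the domain algebra matter.\<close>

definition linear_map ::
  "(complex^'n^'n) set \<Rightarrow> (complex^'m^'m) set \<Rightarrow> (complex^'n^'n \<Rightarrow> complex^'m^'m) \<Rightarrow> bool" where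
  "linear_map B C f \<longleftrightarrow>
     f ` B \<subseteq> C \<and>
     (\<forall>a\<in>B. \<forall>b\<in>B. f (a + b) = f a + f b) \<and>
     (\<forall>c. \<forall>a\<in>B. f (cscale c a) = cscale c (f a))"

definition positive_map ::
  "(complex^'n^'n) set \<Rightarrow> (complex^'m^'m) set \<Rightarrow> (complex^'n^'n \<Rightarrow> complex^'m^'m) \<Rightarrow> bool" where
  "positive_map B C f \<longleftrightarrow>
     linear_map B C f \<and> (\<forall>a\<in>B. positive_operator a \<longrightarrow> positive_operator (f a))"

text \<open>\<open>f \<otimes> \<iota>\<^sub>k\<close> acts entrywise, \<open>f \<otimes> \<theta>\<^sub>k\<close> acts entrywise and swaps the two indices.\<close>

definition k_positive :: "nat \<Rightarrow>
    (complex^'n^'n) set \<Rightarrow> (complex^'m^'m) set \<Rightarrow> (complex^'n^'n \<Rightarrow> complex^'m^'m) \<Rightarrow> bool" where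
  "k_positive k B C f \<longleftrightarrow>
     linear_map B C f \<and>
     (\<forall>a\<in>mat_over k B. positive_block k a \<longrightarrow> positive_block k (\<lambda>i j. f (a i j)))"

definition k_copositive :: "nat \<Rightarrow>
    (complex^'n^'n) set \<Rightarrow> (complex^'m^'m) set \<Rightarrow> (complex^'n^'n \<Rightarrow> complex^'m^'m) \<Rightarrow> bool" where
  "k_copositive k B C f \<longleftrightarrow>
     linear_map B C f \<and>
     (\<forall>a\<in>mat_over k B. positive_block k a \<longrightarrow> positive_block k (\<lambda>i j. f (a j i)))"

definition completely_positive ::
  "(complex^'n^'n) set \<Rightarrow> (complex^'m^'m) set \<Rightarrow> (complex^'n^'n \<Rightarrow> complex^'m^'m) \<Rightarrow> bool" where
  "completely_positive B C f \<longleftrightarrow> (\<forall>k. k_positive k B C f)"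

definition copositive ::
  "(complex^'n^'n) set \<Rightarrow> (complex^'m^'m) set \<Rightarrow> (complex^'n^'n \<Rightarrow> complex^'m^'m) \<Rightarrow> bool" where
  "copositive B C f \<longleftrightarrow> (\<forall>k. k_copositive k B C f)"

definition decomposable ::
  "(complex^'n^'n) set \<Rightarrow> (complex^'m^'m) set \<Rightarrow> (complex^'n^'n \<Rightarrow> complex^'m^'m) \<Rightarrow> bool" where
  "decomposable B C f \<longleftrightarrow>
     positive_map B C f \<and>
     (\<exists>g h. completely_positive B C g \<and> copositive B C h \<and> (\<forall>a\<in>B. f a = g a + h a))"

definition two_two_decomposable ::
  "(complex^'n^'n) set \<Rightarrow> (complex^'m^'m) set \<Rightarrow> (complex^'n^'n \<Rightarrow> complex^'m^'m) \<Rightarrow> bool" where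
  "two_two_decomposable B C f \<longleftrightarrow>
     positive_map B C f \<and>
     (\<exists>g h. k_positive 2 B C g \<and> k_copositive 2 B C h \<and> (\<forall>a\<in>B. f a = g a + h a))"

definition atomic ::
  "(complex^'n^'n) set \<Rightarrow> (complex^'m^'m) set \<Rightarrow> (complex^'n^'n \<Rightarrow> complex^'m^'m) \<Rightarrow> bool" where
  "atomic B C f \<longleftrightarrow> positive_map B C f \<and> \<not> two_two_decomposable B C f"

definition projection_map ::
  "(complex^'n^'n) set \<Rightarrow> complex^'n^'n \<Rightarrow> (complex^'n^'n \<Rightarrow> complex^'n^'n) \<Rightarrow> bool" where
  "projection_map B e P \<longleftrightarrow> positive_map B B P \<and> P e = e \<and> (\<forall>a\<in>B. P (P a) = P a)"

definition trace_preserving ::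
  "(complex^'n^'n) set \<Rightarrow> (complex^'n^'n \<Rightarrow> complex^'n^'n) \<Rightarrow> bool" where
  "trace_preserving B P \<longleftrightarrow> (\<forall>a\<in>B. trace (P a) = trace a)"


subsection \<open>Jordan algebras of self-adjoint operators\<close>

definition jordan_prod :: "complex^'n^'n \<Rightarrow> complex^'n^'n \<Rightarrow> complex^'n^'n" where
  "jordan_prod a b = (1/2) *\<^sub>R (a ** b + b ** a)"

definition jordan_algebra_in :: "(complex^'n^'n) set \<Rightarrow> (complex^'n^'n) set \<Rightarrow> bool" where
  "jordan_algebra_in B A \<longleftrightarrow>
     A \<subseteq> self_adjoint_part B \<and> subspace A \<and> (\<forall>a\<in>A. \<forall>b\<in>A. jordan_prod a b \<in> A)"

text \<open>The multiplication \<open>*\<close> of the type is componentwise, so \<^const>\<open>prod_list\<close> does not apply.\<close>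

definition matrix_prod :: "(complex^'n^'n) list \<Rightarrow> complex^'n^'n" where
  "matrix_prod as = foldr (**) as (mat 1)"

definition reversible :: "(complex^'n^'n) set \<Rightarrow> bool" where
  "reversible A \<longleftrightarrow>
     (\<forall>as. as \<noteq> [] \<and> set as \<subseteq> A \<longrightarrow> matrix_prod as + matrix_prod (rev as) \<in> A)"

definition nonreversible_jordan_algebra_in ::
  "(complex^'n^'n) set \<Rightarrow> (complex^'n^'n) set \<Rightarrow> bool" where
  "nonreversible_jordan_algebra_in B A \<longleftrightarrow> jordan_algebra_in B A \<and> \<not> reversible A"

end

theory Submission
  imports Defs
begin

text \<open>
  Both equivalences follow from three facts: \<open>A\<close> is a Jordan algebra; if \<open>P\<close> is
  (2,2)-decomposable, then \<open>A\<close> is reversible; and if \<open>A\<close> is reversible, then \<open>P\<close> is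
  decomposable. On matrices \<open>inner a b\<close> is the real number \<open>Re (trace (a ** adj b))\<close>.

  \<^bold>\<open>Jordan algebra.\<close> Let \<open>u\<close> be self-adjoint and \<open>x\<close> a unit eigenvector of \<open>P u\<close> with
  eigenvalue \<open>\<mu>\<close>. Applying \<open>P\<close> to the positive element \<open>(u - \<mu> e)\<^sup>2\<close> gives \<open>\<mu>\<^sup>2 \<le> inner (P (u\<^sup>2) x) x\<close>.
  Summation over an orthonormal eigenbasis yields \<open>trace ((P u)\<^sup>2) \<le> trace (P (u\<^sup>2)) = trace (u\<^sup>2)\<close>, and
  equality forces \<open>P (u\<^sup>2) = (P u)\<^sup>2\<close> (\<open>trace_Kadison\<close>). Equality does hold on \<open>A\<close>, so \<open>A\<close> is closed
  under squares. The inequality also says that the idempotent \<open>P\<close> is a contraction, hence that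
  on self-adjoint elements it is the orthogonal projection onto \<open>A\<close> (\<open>P_orthogonal\<close>).

  \<^bold>\<open>From a (2,2)-decomposition to reversibility.\<close> Let \<open>P = g + h\<close>, with \<open>g\<close> 2-positive and
  \<open>h\<close> 2-copositive, and let \<open>a\<close> be in \<open>A\<close>. The positive blocks with rows \<open>(e, y)\<close> and
  \<open>(y*, y* y)\<close>, for \<open>y = x + t a\<close>, tested on the vector \<open>(- t a \<eta>, \<eta>)\<close>, give for each summand a
  nonnegative polynomial of degree two in \<open>t\<close>. The two coefficients of \<open>t\<^sup>2\<close> are nonnegative and
  add up to the value for \<open>P\<close>, which is zero because \<open>P (a\<^sup>2) = a\<^sup>2\<close>. So both polynomials are affine, and
  the slope of a nonnegative affine function vanishes. This means that \<open>g (a x) = a g(x)\<close> and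
  \<open>h (a x) = h(x) a\<close> (\<open>schwarz_defect_0_imp\<close>). Consequently \<open>g w = w g(e)\<close> and
  \<open>h w = h(e) w*\<close> for words \<open>w\<close> in \<open>A\<close>, where \<open>g(e)\<close> and \<open>h(e)\<close> commute with \<open>A\<close> and add
  up to \<open>e\<close>. So \<open>P\<close> fixes \<open>w + w*\<close>.

  \<^bold>\<open>From reversibility to a decomposition.\<close> Let \<open>R\<close> be the real *-algebra generated by \<open>A\<close>.
  Reversibility says that the self-adjoint part of \<open>R\<close> is \<open>A\<close>, so on self-adjoint elements \<open>P\<close>
  is the real orthogonal projection onto \<open>R\<close>. Let \<open>F\<close> be the complex linear part of this projection, and
  \<open>H\<close> its conjugate linear part composed with the adjoint. Then \<open>P = F + H\<close>, and with an
  orthonormal basis \<open>N\<close> of \<open>R\<close>,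
  \<open>2 F(x) = (\<Sum>r\<in>N. trace (x r*) r)\<close> and \<open>2 H(x) = (\<Sum>r\<in>N. trace (x r) r)\<close>.
  To see that \<open>F\<close> is completely positive and \<open>H\<close> copositive, write \<open>D\<close> for \<open>\<Sum>r. r \<otimes> r'\<close>, where \<open>r'\<close> is the
  conjugate of \<open>r\<close> for \<open>F\<close> and \<open>r\<close> itself for \<open>H\<close>. The Casimir element \<open>c = (\<Sum>s\<in>N. s* s)\<close> is
  central, positive and invertible in \<open>R\<close>, and \<open>D\<^sup>2 = D (c \<otimes> 1)\<close>. Hence
  \<open>D (c\<^sup>2 \<otimes> 1) = D (c \<otimes> 1) D\<close>, which is an explicit sum of terms \<open>v v*\<close>
  (\<open>basis_sum_casimir_square\<close>), and the factor \<open>c\<^sup>2\<close> is removed by conjugating the argument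
  with the inverse of \<open>c\<close> (\<open>kraus_expand\<close>).
\<close>

section \<open>Complex matrices, adjoints and traces\<close>

lemma cinner_add_left: "cinner (x + y) z = cinner x z + cinner y z"
  and cinner_add_right: "cinner x (y + z) = cinner x y + cinner x z"
  and cinner_diff_left: "cinner (x - y) z = cinner x z - cinner y z"
  and cinner_zero_left [simp]: "cinner 0 z = 0"
  and cinner_zero_right [simp]: "cinner z 0 = 0"
  by (simp_all add: cinner_def algebra_simps sum.distrib sum_subtractf)

lemma cinner_sum_left: "cinner (\<Sum>i\<in>I. f i) z = (\<Sum>i\<in>I. cinner (f i) z)"
  by (induction I rule: infinite_finite_induct) (simp_all add: cinner_add_left)

lemma cinner_sum_right: "cinner z (\<Sum>i\<in>I. f i) = (\<Sum>i\<in>I. cinner z (f i))"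
  by (induction I rule: infinite_finite_induct) (simp_all add: cinner_add_right)

lemma cinner_mult_left: "cinner (c *s x) y = c * cinner x y"
  and cinner_mult_right: "cinner x (c *s y) = cnj c * cinner x y"
  by (simp_all add: cinner_def sum_distrib_left algebra_simps)

lemma cinner_scaleR_left: "cinner (t *\<^sub>R x) y = of_real t * cinner x y"
  and cinner_scaleR_right: "cinner x (t *\<^sub>R y) = of_real t * cinner x y"
  by (simp_all add: cinner_def sum_distrib_left algebra_simps)
    (simp_all add: scaleR_conv_of_real)

lemma cinner_minus_left: "cinner (- x) y = - cinner x y"
  and cinner_minus_right: "cinner x (- y) = - cinner x y"
  by (simp_all add: cinner_def sum_negf)

lemma cinner_commute: "cinner y x = cnj (cinner x y)"
  by (simp add: cinner_def mult.commute)

lemma inner_eq_Re_cinner: "inner x y = Re (cinner x y)"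
  by (simp add: cinner_def inner_vec_def inner_complex_def)

lemma cinner_self: "cinner x x = of_real ((norm x)\<^sup>2)"
  by (rule complex_eqI)
    (simp_all add: power2_norm_eq_inner inner_eq_Re_cinner, simp add: cinner_def mult.commute)

lemma adj_nth [simp]: "adj a $ i $ j = cnj (a $ j $ i)"
  by (simp add: adj_def map_matrix_def transpose_def)

lemma cscale_nth [simp]: "cscale c a $ i $ j = c * a $ i $ j"
  by (simp add: cscale_def map_matrix_def)

lemma adj_adj [simp]: "adj (adj a) = a"
  and adj_add: "adj (a + b) = adj a + adj b"
  and adj_diff: "adj (a - b) = adj a - adj b"
  and adj_zero [simp]: "adj 0 = 0"
  and adj_scaleR: "adj (t *\<^sub>R a) = t *\<^sub>R adj a"
  and adj_cscale: "adj (cscale c a) = cscale (cnj c) (adj a)"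
  by (simp_all add: vec_eq_iff)

lemma adj_mat_1 [simp]: "adj (mat 1) = mat 1"
  by (simp add: vec_eq_iff mat_def)

lemma adj_sum: "adj (\<Sum>i\<in>I. f i) = (\<Sum>i\<in>I. adj (f i))"
  by (induction I rule: infinite_finite_induct) (simp_all add: adj_add)

lemma adj_mult: "adj (a ** b) = adj b ** adj a"
  by (simp add: vec_eq_iff matrix_matrix_mult_def mult.commute)

lemma cscale_mult_left: "cscale c a ** b = cscale c (a ** b)"
  and cscale_mult_right: "a ** cscale c b = cscale c (a ** b)"
  by (simp_all add: vec_eq_iff matrix_matrix_mult_def sum_distrib_left algebra_simps)

lemma cscale_0_right [simp]: "cscale c 0 = 0"
  and cscale_cscale [simp]: "cscale c (cscale d a) = cscale (c * d) a"
  by (simp_all add: vec_eq_iff)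

lemma cscale_add: "cscale c (a + b) = cscale c a + cscale c b"
  and cscale_add_left: "cscale (c + d) a = cscale c a + cscale d a"
  and cscale_of_real: "cscale (of_real t) a = t *\<^sub>R a"
  by (simp_all add: vec_eq_iff algebra_simps) (simp add: scaleR_conv_of_real)

lemma cscale_sum: "cscale c (\<Sum>i\<in>I. f i) = (\<Sum>i\<in>I. cscale c (f i))"
  by (induction I rule: infinite_finite_induct) (simp_all add: cscale_add)

lemma cscale_scaleR: "cscale c (t *\<^sub>R a) = t *\<^sub>R cscale c a"
  by (simp add: mult.commute flip: cscale_of_real)

lemma cscale_vector: "cscale c a *v x = c *s (a *v x)"
  by (simp add: vec_eq_iff matrix_vector_mult_def sum_distrib_left algebra_simps)

lemma scaleR_mult_left: "(t *\<^sub>R a) ** b = t *\<^sub>R (a ** b)"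
  and scaleR_mult_right: "a ** (t *\<^sub>R b) = t *\<^sub>R (a ** b)" for a b :: "complex^'n^'n"
  by (simp_all flip: cscale_of_real add: cscale_mult_left cscale_mult_right)

lemma scaleR_vector: "(t *\<^sub>R a) *v x = t *\<^sub>R (a *v x)"
  and vector_scaleR: "a *v (t *\<^sub>R x) = t *\<^sub>R (a *v x)" for a :: "complex^'n^'n"
  by (simp_all add: vec_eq_iff matrix_vector_mult_def scaleR_sum_right)

lemma vector_minus: "a *v (- x) = - (a *v x)" for a :: "complex^'n^'n"
  using vector_scaleR[of a "-1" x] by simp

lemma mult_add_left: "(a + b) ** c = a ** c + b ** c" for a b c :: "complex^'n^'n"
  by (simp add: vec_eq_iff matrix_matrix_mult_def sum.distrib algebra_simps)
lemma mult_minus_left: "(- a) ** b = - (a ** b)" for a b :: "complex^'n^'n"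
  using scaleR_mult_left[of "-1"] by simp
lemma mult_diff_left: "(a - b) ** c = a ** c - b ** c" for a b c :: "complex^'n^'n"
  by (simp add: diff_conv_add_uminus mult_add_left mult_minus_left del: add_uminus_conv_diff)
lemma mult_diff_right: "c ** (a - b) = c ** a - c ** b" for a b c :: "complex^'n^'n"
  using matrix_add_ldistrib[of c a "-b"] scaleR_mult_right[of c "-1" b] by simp

lemma mult_sum_left: "(\<Sum>i\<in>I. f i) ** b = (\<Sum>i\<in>I. f i ** b)" for b :: "complex^'n^'n" and f :: "_ \<Rightarrow> complex^'n^'n"
  by (induction I rule: infinite_finite_induct) (simp_all add: mult_add_left)
lemma mult_sum_right: "b ** (\<Sum>i\<in>I. f i) = (\<Sum>i\<in>I. b ** f i)" for f :: "_ \<Rightarrow> complex^'n^'n"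
  by (induction I rule: infinite_finite_induct) (simp_all add: matrix_add_ldistrib)
lemma sum_vector: "(\<Sum>i\<in>I. f i) *v x = (\<Sum>i\<in>I. f i *v x)" for x :: "complex^'n"
  by (induction I rule: infinite_finite_induct) (simp_all add: matrix_vector_mult_add_rdistrib)
lemma vector_sum: "a *v (\<Sum>i\<in>I. f i) = (\<Sum>i\<in>I. a *v f i)" for a :: "complex^'n^'n"
  by (induction I rule: infinite_finite_induct) (simp_all add: matrix_vector_right_distrib)

lemma cinner_adj: "cinner (a *v x) y = cinner x (adj a *v y)"
proof -
  have "cinner (a *v x) y = (\<Sum>i\<in>UNIV. \<Sum>j\<in>UNIV. a$i$j * x$j * cnj (y$i))"
    by (simp add: cinner_def matrix_vector_mult_def sum_distrib_right)
  also have "\<dots> = (\<Sum>j\<in>UNIV. \<Sum>i\<in>UNIV. a$i$j * x$j * cnj (y$i))"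
    by (rule sum.swap)
  also have "\<dots> = cinner x (adj a *v y)"
    by (simp add: cinner_def matrix_vector_mult_def sum_distrib_left ac_simps)
  finally show ?thesis .
qed

lemma inner_eq_Re_trace: "inner a b = Re (trace (a ** adj b))" for a b :: "complex^'n^'n"
  by (simp add: inner_vec_def inner_complex_def trace_def matrix_matrix_mult_def)

lemma trace_cscale: "trace (cscale c a) = c * trace a"
  by (simp add: trace_def sum_distrib_left)

lemma trace_adj: "trace (adj a) = cnj (trace a)"
  by (simp add: trace_def)

lemma inner_adj: "inner (adj a) (adj b) = inner a b" for a b :: "complex^'n^'n"
proof -
  have "inner (adj a) (adj b) = (\<Sum>i\<in>UNIV. \<Sum>j\<in>UNIV. inner (a $ j $ i) (b $ j $ i))"
    by (simp add: inner_vec_def inner_complex_def)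
  also have "\<dots> = inner a b"
    unfolding inner_vec_def by (rule sum.swap)
  finally show ?thesis .
qed

lemma inner_matrix_mult_right: "inner (a ** b) c = inner a (c ** adj b)" for a b c :: "complex^'n^'n"
  by (simp add: inner_eq_Re_trace adj_mult matrix_mul_assoc)

text \<open>Over the complex numbers an operator is determined by its quadratic form.\<close>
lemma operator_eq_0_if_form_eq_0:
  assumes "\<And>x. cinner (a *v x) x = 0"
  shows "a = 0"
proof -
  have polar: "cinner (a *v x) y = 0" for x y
  proof -
    have 1: "cinner (a *v x) y + cinner (a *v y) x = 0"
      using assms[of "x + y"] assms[of x] assms[of y]
      by (simp add: matrix_vector_right_distrib cinner_add_left cinner_add_right add.commute)
    have 2: "- \<i> * cinner (a *v x) y + \<i> * cinner (a *v y) x = 0"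
      using assms[of "x + \<i> *s y"] assms[of x] assms[of y]
      by (simp add: matrix_vector_right_distrib cinner_add_left cinner_add_right
          vector_scalar_commute cinner_mult_left cinner_mult_right)
    show ?thesis using 1 2 by (simp add: complex_eq_iff)
  qed
  have "a *v x = 0" for x
    using polar[of x "a *v x"] by (simp add: cinner_self)
  thus ?thesis
    by (metis matrix_eq matrix_vector_mult_0)
qed

lemma positive_operator_adj:
  assumes "positive_operator a" shows "adj a = a"
proof -
  have "cinner ((adj a - a) *v x) x = 0" for x
  proof -
    have "cinner (adj a *v x) x = cnj (cinner (a *v x) x)"
      by (simp add: cinner_adj flip: cinner_commute)
    also have "\<dots> = cinner (a *v x) x"
      using assms[unfolded positive_operator_def, rule_format, of x] 
      by (auto simp: complex_nonneg_Reals_iff complex_eq_iff)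
    finally show ?thesis 
      by (simp add: matrix_vector_mult_diff_rdistrib cinner_diff_left)
  qed
  thus ?thesis using operator_eq_0_if_form_eq_0 by fastforce
qed

section \<open>Spectral theorem for symmetric operators\<close>

lemma nonneg_affine_imp_slope_0:
  fixes b c :: real
  assumes "\<And>t. 0 \<le> c + t * b"
  shows "b = 0"
proof (rule ccontr)
  assume "b \<noteq> 0"
  with assms[of "- (c + 1) / b"] show False by simp
qed

text \<open>
  If the linear term did not vanish, it would dominate near \<open>t = 0\<close>, with both signs.
\<close>
lemma nonneg_quadratic_imp_slope_0:
  fixes b c :: real
  assumes "\<And>t. 0 \<le> t * b + t\<^sup>2 * c"
  shows "b = 0"
proof (rule ccontr)
  assume b: "b \<noteq> 0"
  have c: "0 \<le> c"
    using assms[of 1] assms[of "-1"] by simp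
  define t where "t = - b / (c + 1)"
  have t: "t * (c + 1) = - b" "t \<noteq> 0"
    using b c by (simp_all add: t_def)
  have "t * b + t\<^sup>2 * c = t * (b + t * (c + 1)) - t\<^sup>2"
    by (simp add: algebra_simps power2_eq_square)
  also have "\<dots> < 0" using t by simp
  finally show False using assms[of t] by simp
qed

text \<open>
  A nonnegative form that vanishes at \<open>x\<close> has a minimum there, so its derivative at \<open>x\<close> in the
  direction of \<open>f x\<close> is zero.
\<close>
lemma positive_form_kernel:
  fixes f :: "'a::real_inner \<Rightarrow> 'a"
  assumes "subspace V" "linear f" "f ` V \<subseteq> V"
    and sym: "\<And>x y. x \<in> V \<Longrightarrow> y \<in> V \<Longrightarrow> inner (f x) y = inner x (f y)"
    and pos: "\<And>x. x \<in> V \<Longrightarrow> 0 \<le> inner (f x) x"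
    and x: "x \<in> V" "inner (f x) x = 0"
  shows "f x = 0"
proof -
  have fx: "f x \<in> V" using assms by auto
  have "0 \<le> t * (2 * inner (f x) (f x)) + t\<^sup>2 * inner (f (f x)) (f x)" for t
  proof -
    have "x + t *\<^sub>R f x \<in> V" using assms fx by (simp add: subspace_add subspace_scale)
    from pos[OF this] show ?thesis
      using sym[OF fx fx] sym[OF fx x(1)] sym[OF x(1) fx] x(2)
      by (simp add: linear_add[OF assms(2)] linear_scale[OF assms(2)] inner_add_left
          inner_add_right power2_eq_square algebra_simps)
  qed
  from nonneg_quadratic_imp_slope_0[OF this] show ?thesis by simp
qed

text \<open>
  A maximizer \<open>x\<close> of \<open>inner (f x) x\<close> on the unit sphere of \<open>V\<close> is an eigenvector: if \<open>\<mu>\<close> is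
  the maximum, the form of \<open>\<mu> - f\<close> is nonnegative on \<open>V\<close> and vanishes at \<open>x\<close>.
\<close>
lemma symmetric_operator_eigenvector:
  fixes f :: "'a::euclidean_space \<Rightarrow> 'a"
  assumes V: "subspace V" "V \<noteq> {0}" and f: "linear f" "f ` V \<subseteq> V"
    and sym: "\<And>x y. x \<in> V \<Longrightarrow> y \<in> V \<Longrightarrow> inner (f x) y = inner x (f y)"
  obtains x \<mu> where "x \<in> V" "norm x = 1" "f x = \<mu> *\<^sub>R x"
proof -
  obtain v where v: "v \<in> V" "v \<noteq> 0" using V subspace_0 by blast
  define S where "S = V \<inter> sphere 0 1"
  have "compact S" unfolding S_def
    by (simp add: V(1) closed_subspace closed_Int_compact)
  moreover have "v /\<^sub>R norm v \<in> S"
    using v V(1) by (simp add: S_def subspace_scale)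
  moreover have "continuous_on S (\<lambda>x. inner (f x) x)"
    by (intro continuous_intros linear_continuous_on linear_conv_bounded_linear[THEN iffD1] f)
  ultimately obtain x where x: "x \<in> S" and max: "\<And>y. y \<in> S \<Longrightarrow> inner (f y) y \<le> inner (f x) x"
    using continuous_attains_sup[of S "\<lambda>x. inner (f x) x"] by blast
  define \<mu> where "\<mu> = inner (f x) x"
  have xV: "x \<in> V" "norm x = 1" using x by (auto simp: S_def)
  let ?g = "\<lambda>y. \<mu> *\<^sub>R y - f y"
  have "?g x = 0"
  proof (rule positive_form_kernel[OF V(1), of ?g])
    show "linear ?g"
      by (intro linear_compose_sub f linear_scale_self)
    show "?g ` V \<subseteq> V" using f V(1) by (auto intro: subspace_diff subspace_scale)
    show "inner (?g y) z = inner y (?g z)" if "y \<in> V" "z \<in> V" for y z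
      using sym[OF that] by (simp add: inner_diff_left inner_diff_right)
    show "inner (?g x) x = 0"
      using xV by (simp add: inner_diff_left \<mu>_def power2_norm_eq_inner[symmetric])
    show "0 \<le> inner (?g y) y" if y: "y \<in> V" for y
    proof (cases "y = 0")
      case True thus ?thesis by simp
    next
      case False
      hence "y /\<^sub>R norm y \<in> S" using y V(1) by (simp add: S_def subspace_scale)
      from max[OF this] have "inner (f y) y / (norm y)\<^sup>2 \<le> \<mu>"
        by (simp add: linear_scale[OF f(1)] \<mu>_def power2_eq_square divide_inverse ac_simps)
      with False show ?thesis
        by (simp add: inner_diff_left divide_le_eq power2_norm_eq_inner)
    qed
  qed (use xV in auto)
  hence "f x = \<mu> *\<^sub>R x" by simp
  with xV show ?thesis using that by blast
qed

definition orthonormal :: "'a::real_inner set \<Rightarrow> bool" where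
  "orthonormal N \<longleftrightarrow> finite N \<and> pairwise orthogonal N \<and> (\<forall>x\<in>N. norm x = 1)"

lemma orthonormal_expand:
  assumes N: "orthonormal N" and x: "x \<in> span N"
  shows "(\<Sum>u\<in>N. inner x u *\<^sub>R u) = x"
  using orthonormal_basis_expand[of N x] N x by (auto simp: orthonormal_def)

text \<open>
  Split off one eigenvector; the symmetry of \<open>f\<close> makes its orthogonal complement in \<open>V\<close> invariant.
\<close>
lemma symmetric_operator_eigenbasis:
  fixes f :: "'a::euclidean_space \<Rightarrow> 'a"
  assumes "subspace V" and f: "linear f" "f ` V \<subseteq> V"
    and sym: "\<And>x y. x \<in> V \<Longrightarrow> y \<in> V \<Longrightarrow> inner (f x) y = inner x (f y)"
  obtains N where "orthonormal N" "span N = V" "\<And>x. x \<in> N \<Longrightarrow> \<exists>\<mu>. f x = \<mu> *\<^sub>R x"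
proof -
  have "\<exists>N. orthonormal N \<and> span N = V \<and> (\<forall>x\<in>N. \<exists>\<mu>. f x = \<mu> *\<^sub>R x)"
    using assms
  proof (induction "dim V" arbitrary: V rule: less_induct)
    case less
    show ?case
    proof (cases "V = {0}")
      case True thus ?thesis
        by (intro exI[of _ "{}"]) (simp add: orthonormal_def)
    next
      case False
      obtain x \<mu> where x: "x \<in> V" "norm x = 1" "f x = \<mu> *\<^sub>R x"
        using symmetric_operator_eigenvector[OF less.prems(1) False less.prems(2-4)] by blast
      have xx: "inner x x = 1" using x(2) by (simp add: norm_eq_1)
      define W where "W = V \<inter> {y. inner x y = 0}"
      have W: "subspace W" unfolding W_def
        by (intro subspace_inter less.prems subspace_hyperplane)
      have fW: "f ` W \<subseteq> W"
      proof
        fix z assume "z \<in> f ` W"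
        then obtain y where y: "y \<in> V" "inner x y = 0" "z = f y" by (auto simp: W_def)
        have "inner x z = inner (f x) y" using less.prems(4)[OF x(1) y(1)] y by simp
        also have "\<dots> = 0" using x y by simp
        finally show "z \<in> W" using y less.prems(3) by (auto simp: W_def)
      qed
      have "x \<notin> W" using xx by (simp add: W_def)
      hence "W \<subset> V" using x(1) unfolding W_def by blast
      hence "dim W < dim V"
        using W less.prems(1) by (metis dim_psubset span_eq_iff)
      then obtain N where N: "orthonormal N" "span N = W" "\<And>x. x \<in> N \<Longrightarrow> \<exists>\<mu>. f x = \<mu> *\<^sub>R x"
        using less.hyps[OF _ W less.prems(2) fW] less.prems(4) unfolding W_def by blast
      have NW: "y \<in> W" if "y \<in> N" for y using N(2) that span_base by blast
      have "orthonormal (insert x N)"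
        using N(1) NW x(2) unfolding orthonormal_def W_def
        by (auto simp: pairwise_insert orthogonal_def inner_commute)
      moreover have "span (insert x N) = V"
      proof
        have "insert x N \<subseteq> V" using NW x by (auto simp: W_def)
        thus "span (insert x N) \<subseteq> V" using less.prems(1) by (simp add: span_minimal)
        show "V \<subseteq> span (insert x N)"
        proof
          fix v assume v: "v \<in> V"
          have "v - inner x v *\<^sub>R x \<in> W"
            using v x(1) xx less.prems(1)
            by (simp add: W_def subspace_diff subspace_scale inner_diff_right)
          thus "v \<in> span (insert x N)" using N(2) span_breakdown_eq by blast
        qed
      qed
      ultimately show ?thesis using N(3) x(3) by blast
    qed
  qed
  thus ?thesis using that by blast
qed

lemma orthonormal_trace:
  fixes f :: "'a::euclidean_space \<Rightarrow> 'a"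
  assumes N: "orthonormal N" "span N = UNIV" and f: "linear f"
  shows "(\<Sum>x\<in>N. inner (f x) x) = (\<Sum>b\<in>Basis. inner (f b) b)"
proof -
  have "(\<Sum>b\<in>Basis. inner (f b) b) = (\<Sum>b\<in>Basis. inner (f (\<Sum>x\<in>N. inner b x *\<^sub>R x)) b)"
    using orthonormal_expand[OF N(1)] N(2) by simp
  also have "\<dots> = (\<Sum>b\<in>Basis. \<Sum>x\<in>N. inner b x * inner (f x) b)"
    by (simp add: linear_sum[OF f] linear_scale[OF f] inner_sum_left)
  also have "\<dots> = (\<Sum>x\<in>N. \<Sum>b\<in>Basis. inner (f x) b * inner x b)"
    by (subst sum.swap) (simp add: mult.commute inner_commute)
  also have "\<dots> = (\<Sum>x\<in>N. inner (f x) x)"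
    by (intro sum.cong refl euclidean_inner[symmetric])
  finally show ?thesis by simp
qed

text \<open>
  Each complex coordinate contributes two real ones, whence the factor 2.
\<close>
lemma Basis_trace:
  fixes a :: "complex^'n^'n"
  shows "(\<Sum>b\<in>Basis. inner (a *v b) b) = 2 * Re (trace a)"
proof -
  have diagonal: "(a *v axis i u) $ i = a $ i $ i * u" for i u
    by (simp add: matrix_vector_mult_def axis_def if_distrib cong: if_cong)
  let ?ax = "\<lambda>(i::'n, u::complex). axis i u"
  have "bij_betw ?ax (UNIV \<times> {1, \<i>}) Basis"
    by (auto simp: bij_betw_def inj_on_def axis_eq_axis Basis_vec_def Basis_complex_def)
  from sum.reindex_bij_betw[OF this, of "\<lambda>b. inner (a *v b) b"]
  have "(\<Sum>b\<in>Basis. inner (a *v b) b)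
      = (\<Sum>(i, u)\<in>UNIV \<times> {1, \<i>}. inner (a *v axis i u) (axis i u))"
    by (simp add: case_prod_unfold)
  also have "\<dots> = (\<Sum>i\<in>UNIV. \<Sum>u\<in>{1, \<i>}. inner (a *v axis i u) (axis i u))"
    by (rule sum.cartesian_product[symmetric])
  also have "\<dots> = (\<Sum>i\<in>UNIV. 2 * Re (a $ i $ i))"
    by (simp add: inner_axis diagonal inner_complex_def)
  finally show ?thesis by (simp add: trace_def sum_distrib_left)
qed

text \<open>
  The space of vectors is treated as a real inner product space, so \<open>N\<close> has twice as many elements as
  there are coordinates; only comparisons of traces are made, so the factor 2 is harmless.
\<close>
lemma trace_eigenbasis:
  fixes c :: "complex^'n^'n"
  assumes "adj c = c"
  obtains N where "orthonormal N" "span N = UNIV" "\<And>x. x \<in> N \<Longrightarrow> \<exists>\<mu>. c *v x = \<mu> *\<^sub>R x"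
    "\<And>a. 2 * Re (trace a) = (\<Sum>x\<in>N. inner (a *v x) x)"
proof -
  obtain N where N: "orthonormal N" "span N = UNIV" "\<And>x. x \<in> N \<Longrightarrow> \<exists>\<mu>. c *v x = \<mu> *\<^sub>R x"
  proof (rule symmetric_operator_eigenbasis[of UNIV "\<lambda>x. c *v x"])
    show "inner (c *v x) y = inner x (c *v y)" for x y
      using assms by (simp add: inner_eq_Re_cinner cinner_adj)
  qed (auto intro: that)
  have "2 * Re (trace a) = (\<Sum>x\<in>N. inner (a *v x) x)" for a
    using orthonormal_trace[OF N(1,2), of "\<lambda>x. a *v x"] by (simp add: Basis_trace)
  with N show ?thesis using that by blast
qed

section \<open>Trace preserving projections and their Jordan algebras\<close>

lemma positive_operator_iff: "positive_operator a \<longleftrightarrow> adj a = a \<and> (\<forall>x. 0 \<le> inner (a *v x) x)"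
proof
  assume a: "positive_operator a"
  then show "adj a = a \<and> (\<forall>x. 0 \<le> inner (a *v x) x)"
    using positive_operator_adj[OF a]
    by (auto simp: positive_operator_def inner_eq_Re_cinner complex_nonneg_Reals_iff)
next
  assume a: "adj a = a \<and> (\<forall>x. 0 \<le> inner (a *v x) x)"
  have "cinner (a *v x) x = cnj (cinner (a *v x) x)" for x
    using a cinner_adj[of a x x] cinner_commute[of "a *v x" x] by simp
  with a show "positive_operator a"
    by (simp add: positive_operator_def complex_nonneg_Reals_iff inner_eq_Re_cinner complex_eq_iff)
qed

lemma positive_operator_square:
  assumes "adj a = a" shows "positive_operator (a ** a)"
  using assms
  by (simp add: positive_operator_def adj_mult cinner_adj[of a] cinner_self
      flip: matrix_vector_mul_assoc)

lemma positive_operator_kernel: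
  assumes "positive_operator a" "inner (a *v x) x = 0"
  shows "a *v x = 0"
proof (rule positive_form_kernel[of UNIV "\<lambda>x. a *v x"])
  show "inner (a *v x) y = inner x (a *v y)" for x y
    using assms(1) by (simp add: inner_eq_Re_cinner cinner_adj positive_operator_iff)
qed (use assms in \<open>auto simp: positive_operator_iff\<close>)

locale unital_cstar_algebra =
  fixes B :: "(complex^'n^'n) set" and e :: "complex^'n^'n"
  assumes cstar: "cstar_algebra B" and unit: "is_unit_of e B"
begin

lemma B_zero: "0 \<in> B" and B_add: "a \<in> B \<Longrightarrow> b \<in> B \<Longrightarrow> a + b \<in> B"
  and B_cscale: "a \<in> B \<Longrightarrow> cscale c a \<in> B" and B_mult: "a \<in> B \<Longrightarrow> b \<in> B \<Longrightarrow> a ** b \<in> B"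
  and B_adj: "a \<in> B \<Longrightarrow> adj a \<in> B"
  using cstar by (auto simp: cstar_algebra_def)

lemma B_scaleR: "a \<in> B \<Longrightarrow> t *\<^sub>R a \<in> B"
  using B_cscale[of a "of_real t"] by (simp add: cscale_of_real)

lemma B_subspace: "subspace B"
  by (simp add: subspace_def B_zero B_add B_scaleR)

lemma unit_B: "e \<in> B" and unit_left: "a \<in> B \<Longrightarrow> e ** a = a" and unit_right: "a \<in> B \<Longrightarrow> a ** e = a"
  using unit by (auto simp: is_unit_of_def)

lemma unit_adj: "adj e = e"
  by (metis adj_adj adj_mult B_adj unit_B unit_left)

lemma self_adjoint_split:
  assumes "a \<in> B"
  obtains b c where "b \<in> self_adjoint_part B" "c \<in> self_adjoint_part B" "a = b + cscale \<i> c"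
proof
  show "(1/2) *\<^sub>R (a + adj a) \<in> self_adjoint_part B"
    using assms by (simp add: self_adjoint_part_def B_scaleR B_add B_adj adj_scaleR adj_add add.commute)
  show "cscale (- \<i> / 2) (a - adj a) \<in> self_adjoint_part B"
    using assms B_subspace
    by (simp add: self_adjoint_part_def B_cscale subspace_diff B_adj adj_cscale adj_diff)
      (simp add: vec_eq_iff algebra_simps)
  show "a = (1/2) *\<^sub>R (a + adj a) + cscale \<i> (cscale (- \<i> / 2) (a - adj a))"
    by (simp add: vec_eq_iff complex_eq_iff field_simps)
qed

lemma self_adjoint_subspace: "subspace (self_adjoint_part B)"
  by (simp add: subspace_def self_adjoint_part_def B_zero B_add B_scaleR adj_add adj_scaleR)

lemma self_adjoint_square: "u \<in> self_adjoint_part B \<Longrightarrow> u ** u \<in> self_adjoint_part B"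
  by (simp add: self_adjoint_part_def B_mult adj_mult)

end

locale trace_preserving_projection = unital_cstar_algebra B e
  for B :: "(complex^'n^'n) set" and e :: "complex^'n^'n" +
  fixes P :: "complex^'n^'n \<Rightarrow> complex^'n^'n" and A :: "(complex^'n^'n) set"
  assumes projection: "projection_map B e P" and trace_P: "trace_preserving B P"
    and A_eq: "A = P ` self_adjoint_part B"
begin

lemma P_B: "a \<in> B \<Longrightarrow> P a \<in> B" and P_add: "a \<in> B \<Longrightarrow> b \<in> B \<Longrightarrow> P (a + b) = P a + P b"
  and P_cscale: "a \<in> B \<Longrightarrow> P (cscale c a) = cscale c (P a)"
  and P_pos: "a \<in> B \<Longrightarrow> positive_operator a \<Longrightarrow> positive_operator (P a)"
  and P_unit: "P e = e" and P_idem: "a \<in> B \<Longrightarrow> P (P a) = P a"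
  and P_trace: "a \<in> B \<Longrightarrow> trace (P a) = trace a"
  using projection trace_P
  by (auto simp: projection_map_def positive_map_def linear_map_def trace_preserving_def)

lemma P_scaleR: "a \<in> B \<Longrightarrow> P (t *\<^sub>R a) = t *\<^sub>R P a"
  using P_cscale[of a "of_real t"] by (simp add: cscale_of_real)

lemma P_diff: "a \<in> B \<Longrightarrow> b \<in> B \<Longrightarrow> P (a - b) = P a - P b"
  using P_add[of a "-1 *\<^sub>R b"] P_scaleR[of b "-1"] B_scaleR[of b "-1"] by simp

text \<open>
  \<open>P\<close> is positive, and \<open>4 u = (u + e)\<^sup>2 - (u - e)\<^sup>2\<close> is a difference of positive elements.
\<close>
lemma P_self_adjoint:
  assumes u: "u \<in> self_adjoint_part B" shows "P u \<in> self_adjoint_part B"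
proof -
  have e: "e \<in> self_adjoint_part B" by (simp add: self_adjoint_part_def unit_B unit_adj)
  have sq: "adj (P (v ** v)) = P (v ** v)" if "v \<in> self_adjoint_part B" for v
    using that by (intro positive_operator_adj[OF P_pos] positive_operator_square)
      (auto simp: self_adjoint_part_def B_mult)
  let ?p = "u + e" and ?q = "u - e"
  have pq: "?p \<in> self_adjoint_part B" "?q \<in> self_adjoint_part B"
    using u e self_adjoint_subspace by (auto intro: subspace_add subspace_diff)
  have "?p ** ?p - ?q ** ?q = 4 *\<^sub>R u"
    using u unit_left[of u] unit_right[of u]
    by (simp add: self_adjoint_part_def mult_add_left mult_diff_left matrix_add_ldistrib
        mult_diff_right) (simp add: vec_eq_iff complex_eq_iff)
  hence "u = (1/4) *\<^sub>R (?p ** ?p - ?q ** ?q)" by simp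
  moreover have "?p ** ?p \<in> B" "?q ** ?q \<in> B"
    using pq by (auto simp: self_adjoint_part_def B_mult)
  ultimately have "P u = (1/4) *\<^sub>R (P (?p ** ?p) - P (?q ** ?q))"
    by (metis P_diff P_scaleR B_subspace subspace_diff)
  hence "adj (P u) = P u" using sq pq by (simp add: adj_scaleR adj_diff)
  with u show ?thesis by (simp add: self_adjoint_part_def P_B)
qed

lemma mem_A_iff: "a \<in> A \<longleftrightarrow> a \<in> self_adjoint_part B \<and> P a = a"
  using P_self_adjoint P_idem by (force simp: A_eq self_adjoint_part_def)

lemma A_subspace: "subspace A"
  using self_adjoint_subspace P_B
  by (auto simp: subspace_def mem_A_iff P_add P_scaleR self_adjoint_part_def)
     (metis B_zero P_scaleR scaleR_zero_left)

lemma unit_A: "e \<in> A"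
  by (simp add: mem_A_iff self_adjoint_part_def unit_B unit_adj P_unit)

text \<open>
  The positive element is \<open>d = (u - \<mu> e)\<^sup>2\<close>. As \<open>e\<close> may be smaller than the identity operator, an
  eigenvector for \<open>\<mu> = 0\<close> may lie outside the range of \<open>e\<close>; there \<open>d = u\<^sup>2\<close> serves.
\<close>
lemma spectral_shift_square:
  fixes x :: "complex^'n"
  assumes u: "u \<in> self_adjoint_part B" and x: "P u *v x = \<mu> *\<^sub>R x"
  obtains d where "d \<in> B" "positive_operator d"
    "P d *v x = P (u ** u) *v x - P u *v (P u *v x)"
proof (cases "\<mu> = 0")
  case True
  show ?thesis
    by (rule that[of "u ** u"])
      (use u x True in \<open>auto simp: self_adjoint_part_def B_mult positive_operator_square\<close>)
next
  case False
  let ?v = "u - \<mu> *\<^sub>R e"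
  have uB: "u \<in> B" "adj u = u" using u by (auto simp: self_adjoint_part_def)
  have "e *v (\<mu> *\<^sub>R x) = \<mu> *\<^sub>R x"
    using x unit_left[OF P_B[OF uB(1)]] by (metis matrix_vector_mul_assoc)
  hence ex: "e *v x = x" using False by (simp add: vector_scaleR)
  have v: "?v \<in> B" "adj ?v = ?v"
    using uB by (auto simp: unit_B B_scaleR B_subspace subspace_diff adj_diff adj_scaleR unit_adj)
  have "?v ** ?v = u ** u - (2 * \<mu>) *\<^sub>R u + (\<mu> * \<mu>) *\<^sub>R e"
    using unit_left[OF uB(1)] unit_right[OF uB(1)] unit_left[OF unit_B]
    by (simp add: mult_diff_left mult_diff_right scaleR_mult_left scaleR_mult_right)
      (simp add: vec_eq_iff algebra_simps complex_eq_iff)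
  hence "P (?v ** ?v) = P (u ** u) - (2 * \<mu>) *\<^sub>R P u + (\<mu> * \<mu>) *\<^sub>R e"
    using uB by (simp add: P_add P_diff P_scaleR P_unit B_mult B_scaleR unit_B B_subspace subspace_diff)
  hence "P (?v ** ?v) *v x = P (u ** u) *v x - P u *v (P u *v x)"
    by (simp add: matrix_vector_mult_add_rdistrib matrix_vector_mult_diff_rdistrib scaleR_vector
        vector_scaleR x ex)
      (simp add: vec_eq_iff complex_eq_iff algebra_simps)
  with v show ?thesis using that[of "?v ** ?v"] by (simp add: B_mult positive_operator_square)
qed

text \<open>
  The trace form of Kadison's inequality, with its case of equality. Each eigenvector \<open>x\<close> of \<open>P u\<close>
  contributes \<open>inner (P d x) x \<ge> 0\<close> for a positive \<open>d\<close>. If the sum of these numbers is zero, then each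
  of them is zero, and positivity of \<open>P d\<close> improves this to \<open>P d x = 0\<close>.
\<close>
lemma trace_Kadison:
  assumes u: "u \<in> self_adjoint_part B"
  shows "Re (trace (P u ** P u)) \<le> Re (trace (u ** u))"
    and "Re (trace (P u ** P u)) = Re (trace (u ** u)) \<Longrightarrow> P (u ** u) = P u ** P u"
proof -
  have uB: "u \<in> B" and sa: "adj (P u) = P u"
    using u P_self_adjoint[OF u] by (auto simp: self_adjoint_part_def)
  obtain N where N: "orthonormal N" "span N = UNIV" "\<And>x. x \<in> N \<Longrightarrow> \<exists>\<mu>. P u *v x = \<mu> *\<^sub>R x"
    and tr: "\<And>a. 2 * Re (trace a) = (\<Sum>x\<in>N. inner (a *v x) x)"
    using trace_eigenbasis[OF sa] by blast
  let ?D = "P (u ** u) - P u ** P u"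
  have D: "0 \<le> inner (?D *v x) x \<and> (inner (?D *v x) x = 0 \<longrightarrow> ?D *v x = 0)" if x: "x \<in> N" for x
  proof -
    obtain \<mu> where "P u *v x = \<mu> *\<^sub>R x" using N(3)[OF x] by blast
    from spectral_shift_square[OF u this] obtain d where d: "d \<in> B" "positive_operator d"
      "P d *v x = P (u ** u) *v x - P u *v (P u *v x)" by blast
    hence "?D *v x = P d *v x"
      by (simp add: matrix_vector_mult_diff_rdistrib matrix_vector_mul_assoc)
    with P_pos[OF d(1,2)] show ?thesis
      using positive_operator_kernel by (auto simp: positive_operator_iff)
  qed
  have sum: "2 * Re (trace (u ** u)) - 2 * Re (trace (P u ** P u)) = (\<Sum>x\<in>N. inner (?D *v x) x)"
    using tr[of ?D] P_trace[OF B_mult[OF uB uB]] by (simp add: trace_sub)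
  show "Re (trace (P u ** P u)) \<le> Re (trace (u ** u))"
    using sum sum_nonneg[of N "\<lambda>x. inner (?D *v x) x"] D by simp
  assume "Re (trace (P u ** P u)) = Re (trace (u ** u))"
  with sum have "(\<Sum>x\<in>N. inner (?D *v x) x) = 0" by simp
  hence "\<forall>x\<in>N. inner (?D *v x) x = 0"
    using D N(1) by (subst (asm) sum_nonneg_eq_0_iff) (auto simp: orthonormal_def)
  hence zero: "?D *v x = 0" if "x \<in> N" for x using D that by blast
  have "?D *v x = 0" for x
  proof -
    have "x \<in> span N" using N(2) by simp
    thus ?thesis
      by (rule linear_eq_0_on_span[rotated 2]) (use zero in auto)
  qed
  hence "?D = 0" by (metis matrix_eq matrix_vector_mult_0)
  thus "P (u ** u) = P u ** P u" by simp
qed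

lemma square_A:
  assumes "a \<in> A" shows "a ** a \<in> A"
proof -
  have a: "a \<in> self_adjoint_part B" "P a = a" using assms by (auto simp: mem_A_iff)
  have "P (a ** a) = a ** a" using trace_Kadison(2)[OF a(1)] a(2) by simp
  with self_adjoint_square[OF a(1)] show ?thesis by (simp add: mem_A_iff)
qed

lemma A_jordan_algebra: "jordan_algebra_in B A"
proof -
  have "jordan_prod a b \<in> A" if "a \<in> A" "b \<in> A" for a b
  proof -
    have "jordan_prod a b = (1/2) *\<^sub>R ((a + b) ** (a + b) - a ** a - b ** b)"
      by (simp add: jordan_prod_def mult_add_left matrix_add_ldistrib)
    moreover have "(a + b) ** (a + b) - a ** a - b ** b \<in> A"
      using that A_subspace by (intro subspace_diff square_A subspace_add)
    ultimately show ?thesis by (simp add: A_subspace subspace_scale)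
  qed
  thus ?thesis using A_subspace by (auto simp: jordan_algebra_in_def mem_A_iff)
qed

text \<open>
  With \<open>y = x - P x\<close>, which \<open>P\<close> annihilates, the contraction property says that \<open>b + t y\<close> is never
  shorter than \<open>b\<close>.
\<close>
lemma P_orthogonal:
  assumes x: "x \<in> self_adjoint_part B" and b: "b \<in> A"
  shows "inner (x - P x) b = 0"
proof -
  define y where "y = x - P x"
  have y: "y \<in> self_adjoint_part B"
    unfolding y_def using x P_self_adjoint self_adjoint_subspace by (blast intro: subspace_diff)
  have Py: "P y = 0" using x by (simp add: y_def self_adjoint_part_def P_diff P_B P_idem)
  have bB: "b \<in> self_adjoint_part B" "P b = b" using b by (auto simp: mem_A_iff)
  have "0 \<le> t * (2 * inner y b) + t\<^sup>2 * inner y y" for t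
  proof -
    let ?u = "b + t *\<^sub>R y"
    have u: "?u \<in> self_adjoint_part B"
      using y bB self_adjoint_subspace by (blast intro: subspace_add subspace_scale)
    have "P ?u = b"
      using y bB Py by (simp add: P_add P_scaleR B_scaleR self_adjoint_part_def)
    with trace_Kadison(1)[OF u] have "inner b b \<le> inner ?u ?u"
      using u bB by (simp add: inner_eq_Re_trace self_adjoint_part_def)
    thus ?thesis
      by (simp add: inner_add_left inner_add_right inner_commute[of b y] power2_eq_square algebra_simps)
  qed
  from nonneg_quadratic_imp_slope_0[OF this] show ?thesis by (simp add: y_def)
qed

end

section \<open>(2,2)-decomposable projections have reversible range\<close>

lemma matrix_prod_simps [simp]: "matrix_prod [] = mat 1" "matrix_prod (a # as) = a ** matrix_prod as"
  by (simp_all add: matrix_prod_def)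

lemma matrix_prod_append: "matrix_prod (as @ bs) = matrix_prod as ** matrix_prod bs"
  by (induction as) (simp_all add: matrix_mul_assoc)

lemma nonneg_affine_imp_slope_0_complex:
  fixes b c :: complex
  assumes "\<And>t::real. c + of_real t * b \<in> \<real>\<^sub>\<ge>\<^sub>0"
  shows "b = 0"
proof -
  have "0 \<le> Re c + t * Re b" "Im c + t * Im b = 0" for t
    using assms[of t] by (simp_all add: complex_nonneg_Reals_iff)
  from nonneg_affine_imp_slope_0[OF this(1)] this(2)[of 0] this(2)[of 1]
  show ?thesis by (simp add: complex_eq_iff)
qed

context unital_cstar_algebra
begin

text \<open>
  This is the Gram block of the pair \<open>(e, y)\<close>, the one that yields the Schwarz
  inequality for 2-positive maps.
\<close>
definition schwarz_block :: "complex^'n^'n \<Rightarrow> nat \<Rightarrow> nat \<Rightarrow> complex^'n^'n" where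
  "schwarz_block y i j = (if i = 0 then if j = 0 then e else y else if j = 0 then adj y else adj y ** y)"

lemma schwarz_block_B: "y \<in> B \<Longrightarrow> schwarz_block y i j \<in> B"
  by (simp add: schwarz_block_def unit_B B_adj B_mult)

lemma positive_schwarz_block:
  assumes "y \<in> B" shows "positive_block 2 (schwarz_block y)"
proof -
  have "(\<Sum>i<2. cinner (\<Sum>j<2. schwarz_block y i j *v x j) (x i))
      = cinner (e *v x 0 + y *v x 1) (e *v x 0 + y *v x 1)" for x
  proof -
    have "cinner (e *v z) (x 0) = cinner (e *v z) (e *v x 0)" for z
      by (metis cinner_adj matrix_vector_mul_assoc unit_B unit_adj unit_left)
    moreover have "cinner (y *v z) (x 0) = cinner (y *v z) (e *v x 0)" for z
      by (metis assms cinner_adj matrix_vector_mul_assoc unit_adj unit_left)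
    moreover have "cinner (adj y *v z) (x 1) = cinner (e *v z) (y *v x 1)" for z
      by (metis B_adj adj_adj assms cinner_adj matrix_vector_mul_assoc unit_right)
    ultimately show ?thesis
      by (simp add: lessThan_nat_numeral schwarz_block_def cinner_add_left cinner_add_right
          cinner_adj[of "adj y"] flip: matrix_vector_mul_assoc) 
  qed
  thus ?thesis by (simp add: positive_block_def cinner_self)
qed

text \<open>
  The value on the vector \<open>(\<xi>, \<eta>)\<close> of the image of the block of \<open>y\<close>. The off-diagonal entries \<open>u y\<close>
  and \<open>v y\<close> are \<open>\<phi> y\<close> and \<open>\<phi> (adj y)\<close> for a 2-positive map, and are exchanged for a 2-copositive
  map, so that one argument serves for both kinds of maps.
\<close>
definition schwarz_form where
  "schwarz_form \<phi> u v y \<xi> \<eta> = cinner (\<phi> e *v \<xi>) \<xi> + cinner (u y *v \<eta>) \<xi>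
     + cinner (v y *v \<xi>) \<eta> + cinner (\<phi> (adj y ** y) *v \<eta>) \<eta>"
  for \<phi> u v :: "complex^'n^'n \<Rightarrow> complex^'n^'n"

lemma k_positive_schwarz_form:
  assumes "k_positive 2 B B g" "y \<in> B"
  shows "schwarz_form g g (\<lambda>y. g (adj y)) y \<xi> \<eta> \<in> \<real>\<^sub>\<ge>\<^sub>0"
proof -
  have "positive_block 2 (\<lambda>i j. g (schwarz_block y i j))"
    using assms positive_schwarz_block by (auto simp: k_positive_def mat_over_def schwarz_block_B)
  from this[unfolded positive_block_def, rule_format, of "\<lambda>i. if i = 0 then \<xi> else \<eta>"]
  show ?thesis
    by (simp add: lessThan_nat_numeral schwarz_block_def schwarz_form_def cinner_add_left ac_simps)
qed

lemma k_copositive_schwarz_form: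
  assumes "k_copositive 2 B B h" "y \<in> B"
  shows "schwarz_form h (\<lambda>y. h (adj y)) h y \<xi> \<eta> \<in> \<real>\<^sub>\<ge>\<^sub>0"
proof -
  have "positive_block 2 (\<lambda>i j. h (schwarz_block y j i))"
    using assms positive_schwarz_block by (auto simp: k_copositive_def mat_over_def schwarz_block_B)
  from this[unfolded positive_block_def, rule_format, of "\<lambda>i. if i = 0 then \<xi> else \<eta>"]
  show ?thesis
    by (simp add: lessThan_nat_numeral schwarz_block_def schwarz_form_def cinner_add_left ac_simps)
qed

text \<open>
  The coefficient of \<open>t\<^sup>2\<close> of the form at \<open>y = x + t a\<close> and the vector \<open>(- t a \<eta>, \<eta>)\<close>.
\<close>
definition schwarz_defect where
  "schwarz_defect \<phi> a \<eta> = cinner (\<phi> e *v (a *v \<eta>)) (a *v \<eta>) - cinner (\<phi> a *v \<eta>) (a *v \<eta>)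
     - cinner (\<phi> a *v (a *v \<eta>)) \<eta> + cinner (\<phi> (a ** a) *v \<eta>) \<eta>"
  for \<phi> :: "complex^'n^'n \<Rightarrow> complex^'n^'n"

lemma schwarz_form_self_adjoint:
  assumes "adj a = a" "u a = \<phi> a" "v a = \<phi> a"
  shows "schwarz_form \<phi> u v a (- (a *v \<eta>)) \<eta> = schwarz_defect \<phi> a \<eta>"
  using assms
  by (simp add: schwarz_form_def schwarz_defect_def vector_minus cinner_minus_left cinner_minus_right)

text \<open>
  A multiplicative domain argument. The vector \<open>(- t a \<eta>, \<eta>)\<close> is chosen because \<open>(- a \<eta>, \<eta>)\<close> is in the
  kernel of the block of \<open>a\<close>. If the coefficient of \<open>t\<^sup>2\<close> vanishes, then so does that of \<open>t\<close>,
  for every \<open>\<eta>\<close>, and this coefficient is the quadratic form of the difference of the two sides.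
\<close>
lemma schwarz_defect_0_imp:
  assumes lin: "linear_map B B \<phi>" 
    and u: "\<And>x t. x \<in> B \<Longrightarrow> u (x + t *\<^sub>R a) = u x + t *\<^sub>R \<phi> a"
    and v: "\<And>x t. x \<in> B \<Longrightarrow> v (x + t *\<^sub>R a) = v x + t *\<^sub>R \<phi> a"
    and pos: "\<And>y \<xi> \<eta>. y \<in> B \<Longrightarrow> schwarz_form \<phi> u v y \<xi> \<eta> \<in> \<real>\<^sub>\<ge>\<^sub>0"
    and defect: "\<And>\<eta>. schwarz_defect \<phi> a \<eta> = 0"
    and a: "a \<in> self_adjoint_part B" and x: "x \<in> B"
  shows "\<phi> (adj x ** a) + \<phi> (a ** x) = a ** u x + v x ** a"
proof -
  let ?T = "\<phi> (adj x ** a) + \<phi> (a ** x) - a ** u x - v x ** a"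
  have add: "\<phi> (b + c) = \<phi> b + \<phi> c" if "b \<in> B" "c \<in> B" for b c
    using lin that by (simp add: linear_map_def)
  have scale: "\<phi> (t *\<^sub>R b) = t *\<^sub>R \<phi> b" if "b \<in> B" for b t
    using lin that unfolding linear_map_def by (metis cscale_of_real)
  have aB: "a \<in> B" "adj a = a" using a by (auto simp: self_adjoint_part_def)
  have "cinner (?T *v \<eta>) \<eta> = 0" for \<eta>
  proof (rule nonneg_affine_imp_slope_0_complex)
    fix t :: real
    let ?y = "x + t *\<^sub>R a" and ?\<xi> = "(- t) *\<^sub>R (a *v \<eta>)"
    have y: "?y \<in> B" using x aB by (simp add: B_add B_scaleR)
    have "adj ?y ** ?y = adj x ** x + t *\<^sub>R (adj x ** a + a ** x) + (t * t) *\<^sub>R (a ** a)"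
      using aB by (simp add: adj_add adj_scaleR mult_add_left matrix_add_ldistrib
          scaleR_mult_left scaleR_mult_right algebra_simps)
    hence sq: "\<phi> (adj ?y ** ?y)
        = \<phi> (adj x ** x) + t *\<^sub>R (\<phi> (adj x ** a) + \<phi> (a ** x)) + (t * t) *\<^sub>R \<phi> (a ** a)"
      using x aB by (simp add: add scale B_add B_scaleR B_mult B_adj)
    have "schwarz_form \<phi> u v ?y ?\<xi> \<eta>
        = cinner (\<phi> (adj x ** x) *v \<eta>) \<eta> + of_real t * cinner (?T *v \<eta>) \<eta>
          + of_real t * of_real t * schwarz_defect \<phi> a \<eta>"
      unfolding schwarz_form_def schwarz_defect_def sq u[OF x] v[OF x]
      using aB(2) by (simp add: vector_scaleR scaleR_vector cinner_scaleR_left cinner_scaleR_right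
          matrix_vector_mult_add_rdistrib matrix_vector_mult_diff_rdistrib cinner_add_left
          cinner_diff_left cinner_adj[of a] vector_minus cinner_minus_left
          cinner_minus_right algebra_simps flip: matrix_vector_mul_assoc)
    with pos[OF y] defect
    show "cinner (\<phi> (adj x ** x) *v \<eta>) \<eta> + of_real t * cinner (?T *v \<eta>) \<eta> \<in> \<real>\<^sub>\<ge>\<^sub>0"
      by (metis add.right_neutral mult_zero_right)
  qed
  from operator_eq_0_if_form_eq_0[OF this] show ?thesis
    by (simp add: algebra_simps)
qed

end

context trace_preserving_projection
begin

lemma matrix_prod_B: "as \<noteq> [] \<Longrightarrow> set as \<subseteq> A \<Longrightarrow> matrix_prod as \<in> B"
  by (induction as rule: list_nonempty_induct) (auto simp: mem_A_iff self_adjoint_part_def B_mult)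

lemma adj_matrix_prod: "set as \<subseteq> A \<Longrightarrow> adj (matrix_prod as) = matrix_prod (rev as)"
  by (induction as) (auto simp: adj_mult matrix_prod_append mem_A_iff self_adjoint_part_def)

text \<open>
  \<open>g\<close> respects left and right multiplication by elements of \<open>A\<close>, and \<open>h\<close> exchanges the two sides.
\<close>
lemma reversible_if_two_two_decomposable:
  assumes "two_two_decomposable B B P" shows "reversible A"
proof -
  obtain g h where g: "k_positive 2 B B g" and h: "k_copositive 2 B B h"
    and gh: "\<And>a. a \<in> B \<Longrightarrow> P a = g a + h a"
    using assms by (auto simp: two_two_decomposable_def)
  have lin: "linear_map B B g" "linear_map B B h"
    using g h by (auto simp: k_positive_def k_copositive_def)
  have add: "g (x + y) = g x + g y" "h (x + y) = h x + h y" if "x \<in> B" "y \<in> B" for x y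
    using lin that by (auto simp: linear_map_def)
  have cscale: "g (cscale c x) = cscale c (g x)" "h (cscale c x) = cscale c (h x)" if "x \<in> B" for c x
    using lin that by (auto simp: linear_map_def)
  have scale: "g (t *\<^sub>R x) = t *\<^sub>R g x" "h (t *\<^sub>R x) = t *\<^sub>R h x" if "x \<in> B" for t x
    using cscale[OF that, of "of_real t"] by (simp_all add: cscale_of_real)
  have mult: "g (a ** x) = a ** g x \<and> g (x ** a) = g x ** a \<and> h (a ** x) = h x ** a \<and> h (x ** a) = a ** h x"
    if a: "a \<in> A" and x: "x \<in> B" for a x
  proof -
    have aB: "a \<in> B" "adj a = a" and asa: "a \<in> self_adjoint_part B"
      using a by (auto simp: mem_A_iff self_adjoint_part_def)
    have sum: "schwarz_defect g a \<eta> + schwarz_defect h a \<eta> = 0" for \<eta>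
    proof -
      have "schwarz_defect g a \<eta> + schwarz_defect h a \<eta> = schwarz_defect P a \<eta>"
        by (simp add: schwarz_defect_def gh aB unit_B B_mult matrix_vector_mult_add_rdistrib
            cinner_add_left)
      also have "\<dots> = cinner (e *v (a *v \<eta>)) (a *v \<eta>) - cinner (a *v (a *v \<eta>)) \<eta>"
        using a square_A[OF a] aB(2)
        by (simp add: schwarz_defect_def mem_A_iff P_unit cinner_adj[of a] flip: matrix_vector_mul_assoc)
      also have "\<dots> = 0"
        using unit_left[OF aB(1)] aB(2) by (simp add: matrix_vector_mul_assoc cinner_adj[of a])
          (metis aB(2) cinner_adj matrix_vector_mul_assoc)
      finally show ?thesis .
    qed
    have pos: "schwarz_defect g a \<eta> \<in> \<real>\<^sub>\<ge>\<^sub>0" "schwarz_defect h a \<eta> \<in> \<real>\<^sub>\<ge>\<^sub>0" for \<eta>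
      using k_positive_schwarz_form[OF g aB(1), of "- (a *v \<eta>)" \<eta>]
        k_copositive_schwarz_form[OF h aB(1), of "- (a *v \<eta>)" \<eta>] aB(2)
      by (simp_all add: schwarz_form_self_adjoint)
    have zero: "schwarz_defect g a \<eta> = 0" "schwarz_defect h a \<eta> = 0" for \<eta>
      using sum[of \<eta>] pos[of \<eta>] by (auto simp: complex_nonneg_Reals_iff complex_eq_iff)
    have g': "g (adj z ** a) + g (a ** z) = a ** g z + g (adj z) ** a" if z: "z \<in> B" for z
      by (rule schwarz_defect_0_imp[OF lin(1) _ _ k_positive_schwarz_form[OF g] zero(1) asa z])
        (simp_all add: add scale aB adj_add adj_scaleR B_adj B_scaleR)
    have h': "h (adj z ** a) + h (a ** z) = a ** h (adj z) + h z ** a" if z: "z \<in> B" for z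
      by (rule schwarz_defect_0_imp[OF lin(2) _ _ k_copositive_schwarz_form[OF h] zero(2) asa z])
        (simp_all add: add scale aB adj_add adj_scaleR B_adj B_scaleR)
    \<comment> \<open>The identities for \<open>z\<close> and for \<open>\<i> z\<close> together separate the linear from the conjugate linear part.\<close>
    have separate: "p = r \<and> q = s" 
      if "q + p = r + s" "cscale (-\<i>) q + cscale \<i> p = cscale \<i> r + cscale (-\<i>) s"
      for p q r s :: "complex^'n^'n"
      using that by (simp add: vec_eq_iff complex_eq_iff) (smt (verit, ccfv_SIG))
    have left: "g (a ** z) = a ** g z \<and> g (adj z ** a) = g (adj z) ** a" if z: "z \<in> B" for z
      using g'[OF z] g'[OF B_cscale[OF z, of \<i>]] z aB
      by (intro separate) (simp_all add: adj_cscale cscale cscale_mult_left cscale_mult_right B_adj B_mult)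
    have right: "h (a ** z) = h z ** a \<and> h (adj z ** a) = a ** h (adj z)" if z: "z \<in> B" for z
      using h'[OF z] h'[OF B_cscale[OF z, of \<i>]] z aB
      by (intro separate) (simp_all add: adj_cscale cscale cscale_mult_left cscale_mult_right B_adj B_mult add.commute)
    show ?thesis
      using left[OF x] right[OF x] left[OF B_adj[OF x]] right[OF B_adj[OF x]] by simp
  qed
  have words: "g w = w ** g e \<and> g w = g e ** w \<and> h w = h e ** w' \<and> h w = w' ** h e"
    if "as \<noteq> []" "set as \<subseteq> A" "w = matrix_prod as" "w' = matrix_prod (rev as)" for as w w'
    using that
  proof (induction as arbitrary: w w' rule: list_nonempty_induct)
    case (single a)
    hence a: "a \<in> A" "a \<in> B" by (auto simp: mem_A_iff self_adjoint_part_def)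
    show ?case
      using mult[OF a(1) unit_B] single unit_left[OF a(2)] unit_right[OF a(2)]
      by simp metis
  next
    case (cons a as)
    let ?u = "matrix_prod as" and ?u' = "matrix_prod (rev as)"
    have a: "a \<in> A" "a \<in> B" and u: "?u \<in> B" using cons.prems cons.hyps
      by (auto simp: mem_A_iff self_adjoint_part_def matrix_prod_B)
    have "g ?u = ?u ** g e \<and> g ?u = g e ** ?u \<and> h ?u = h e ** ?u' \<and> h ?u = ?u' ** h e"
      using cons.prems(1) by (intro cons.IH) auto
    moreover have "g e ** a = a ** g e" "h e ** a = a ** h e"
      using mult[OF a(1) unit_B] unit_left[OF a(2)] unit_right[OF a(2)] by metis+
    ultimately show ?case
      using mult[OF a(1) u] cons.prems(2,3)
      by (simp add: matrix_prod_append) (metis matrix_mul_assoc)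
  qed
  show ?thesis unfolding reversible_def
  proof (intro allI impI)
    fix as assume as: "as \<noteq> [] \<and> set as \<subseteq> A"
    define w w' where "w = matrix_prod as" and "w' = matrix_prod (rev as)"
    have B: "w \<in> B" "w' \<in> B" using as by (auto simp: w_def w'_def intro!: matrix_prod_B)
    have ww: "adj w = w'" "adj w' = w"
      using as adj_matrix_prod[of as] adj_matrix_prod[of "rev as"] by (auto simp: w_def w'_def)
    have e: "g e + h e = e" using gh[OF unit_B] P_unit by simp
    have "P (w + w') = w ** g e + h e ** w' + (g e ** w' + w ** h e)"
    proof -
      have "g w = w ** g e" "h w = h e ** w'"
        using words[of as w w'] as by (auto simp: w_def w'_def)
      moreover have "g w' = g e ** w'" "h w' = w ** h e"
        using words[of "rev as" w' w] as by (auto simp: w_def w'_def)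
      ultimately show ?thesis using B by (simp add: P_add gh)
    qed
    also have "\<dots> = w ** (g e + h e) + (g e + h e) ** w'"
      by (simp add: matrix_add_ldistrib mult_add_left algebra_simps)
    also have "\<dots> = w + w'" using B by (simp add: e unit_left unit_right)
    finally show "matrix_prod as + matrix_prod (rev as) \<in> A"
      using B ww by (simp add: mem_A_iff self_adjoint_part_def B_add adj_add add.commute flip: w_def w'_def)
  qed
qed

end

section \<open>Real *-algebras of matrices and their Casimir element\<close>

lemma nonneg_Reals_sum: "(\<And>i. i \<in> I \<Longrightarrow> f i \<in> \<real>\<^sub>\<ge>\<^sub>0) \<Longrightarrow> (\<Sum>i\<in>I. f i) \<in> \<real>\<^sub>\<ge>\<^sub>0" for f :: "_ \<Rightarrow> complex"
  by (auto simp: complex_nonneg_Reals_iff sum_nonneg)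

lemma half_nonneg: "z \<in> \<real>\<^sub>\<ge>\<^sub>0 \<Longrightarrow> z / 2 \<in> \<real>\<^sub>\<ge>\<^sub>0" for z :: complex
  by (simp add: complex_nonneg_Reals_iff)

lemma bilinear_mult_left: "bilinear f \<Longrightarrow> bilinear (\<lambda>u v. f (u ** a) v)"
  for a :: "complex^'n^'n" and f :: "complex^'n^'n \<Rightarrow> complex^'n^'n \<Rightarrow> 'c::real_vector"
  by (simp add: bilinear_def linear_iff mult_add_left scaleR_mult_left)

lemma trace_eq_sum_cinner: "trace z = (\<Sum>p\<in>UNIV. cinner (z *v axis p 1) (axis p 1))"
proof -
  have "cinner (z *v axis p 1) (axis p 1) = z $ p $ p" for p
    by (simp add: cinner_def matrix_vector_mult_def axis_def if_distrib cong: if_cong)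
  thus ?thesis by (simp add: trace_def)
qed

lemma positive_block_conjugate:
  fixes c :: "complex^'n^'n"
  assumes "positive_block k a" "adj c = c"
  shows "positive_block k (\<lambda>i j. c ** a i j ** c)"
  unfolding positive_block_def
proof
  fix x :: "nat \<Rightarrow> complex^'n"
  show "(\<Sum>i<k. cinner (\<Sum>j<k. (c ** a i j ** c) *v x j) (x i)) \<in> \<real>\<^sub>\<ge>\<^sub>0"
    using assms(1)[unfolded positive_block_def, rule_format, of "\<lambda>i. c *v x i"] assms(2)
    by (simp add: cinner_sum_left cinner_adj[of c] flip: matrix_vector_mul_assoc)
qed

text \<open>
  The algebra is real: it is closed under real scalars only, and \<open>N\<close> is orthonormal for the real
  inner product.
\<close>
locale orthonormal_star_algebra =
  fixes R N :: "(complex^'n^'n) set" and e :: "complex^'n^'n"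
  assumes onb: "orthonormal N" and span_N: "span N = R"
    and R_mult: "a \<in> R \<Longrightarrow> b \<in> R \<Longrightarrow> a ** b \<in> R" and R_adj: "a \<in> R \<Longrightarrow> adj a \<in> R"
    and unit_R: "e \<in> R" and left_unit: "a \<in> R \<Longrightarrow> e ** a = a" and right_unit: "a \<in> R \<Longrightarrow> a ** e = a"
begin

lemma N_R: "r \<in> N \<Longrightarrow> r \<in> R"
  using span_N span_base by blast

lemma R_subspace: "subspace R"
  using span_N subspace_span by blast

lemma adj_unit: "adj e = e"
  by (metis R_adj adj_adj adj_mult left_unit unit_R)

lemma expand: "x \<in> R \<Longrightarrow> (\<Sum>r\<in>N. inner x r *\<^sub>R r) = x"
  using onb span_N by (simp add: orthonormal_expand)

text \<open>
  The element \<open>\<Sum>r\<in>N. r \<otimes> r\<close> of the real tensor square of \<open>R\<close> represents the inner product, so an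
  operator on one tensor factor can be moved to the other as its adjoint. Tensors are
  expressed by evaluating an arbitrary bilinear map.
\<close>
lemma basis_sum_transfer:
  assumes f: "bilinear f" and T: "\<And>r. r \<in> R \<Longrightarrow> T r \<in> R" and T': "\<And>r. r \<in> R \<Longrightarrow> T' r \<in> R"
    and adjoint: "\<And>x y. x \<in> R \<Longrightarrow> y \<in> R \<Longrightarrow> inner (T x) y = inner x (T' y)"
  shows "(\<Sum>r\<in>N. f r (T r)) = (\<Sum>r\<in>N. f (T' r) r)"
proof -
  have "f r (T r) = (\<Sum>s\<in>N. inner (T r) s *\<^sub>R f r s)" if "r \<in> N" for r
    by (subst expand[OF T[OF N_R[OF that]], symmetric])
      (use f in \<open>simp add: bilinear_def linear_sum linear_scale\<close>)
  hence "(\<Sum>r\<in>N. f r (T r)) = (\<Sum>r\<in>N. \<Sum>s\<in>N. inner (T r) s *\<^sub>R f r s)"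
    by simp
  also have "\<dots> = (\<Sum>s\<in>N. \<Sum>r\<in>N. inner (T' s) r *\<^sub>R f r s)"
  proof (subst sum.swap, intro sum.cong refl)
    fix r s assume "r \<in> N" "s \<in> N"
    thus "inner (T r) s *\<^sub>R f r s = inner (T' s) r *\<^sub>R f r s"
      by (metis adjoint N_R inner_commute)
  qed
  also have "\<dots> = (\<Sum>s\<in>N. f (T' s) s)"
  proof (rule sum.cong[OF refl])
    fix s assume "s \<in> N"
    have lin: "linear (\<lambda>u. f u s)" using f by (simp add: bilinear_def)
    show "(\<Sum>r\<in>N. inner (T' s) r *\<^sub>R f r s) = f (T' s) s"
      using linear_sum[OF lin, of "\<lambda>r. inner (T' s) r *\<^sub>R r" N] expand[OF T'[OF N_R[OF \<open>s \<in> N\<close>]]]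
      by (simp add: linear_scale[OF lin])
  qed
  finally show ?thesis .
qed

lemma basis_sum_mult:
  assumes "bilinear f" "a \<in> R"
  shows "(\<Sum>r\<in>N. f r (r ** a)) = (\<Sum>r\<in>N. f (r ** adj a) r)"
  by (rule basis_sum_transfer) (use assms in \<open>auto simp: R_mult R_adj inner_matrix_mult_right\<close>)

lemma basis_sum_adj:
  assumes "bilinear f"
  shows "(\<Sum>r\<in>N. f r (adj r)) = (\<Sum>r\<in>N. f (adj r) r)"
proof (rule basis_sum_transfer[OF assms])
  show "inner (adj x) y = inner x (adj y)" for x y :: "complex^'n^'n"
    using inner_adj[of x "adj y"] by simp
qed (auto simp: R_adj)

definition casimir :: "complex^'n^'n" where "casimir = (\<Sum>s\<in>N. adj s ** s)"

lemma casimir_R: "casimir \<in> R"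
  unfolding casimir_def by (intro subspace_sum R_subspace R_mult R_adj N_R)

lemma adj_casimir: "adj casimir = casimir"
  by (simp add: casimir_def adj_sum adj_mult)

lemma casimir_commute:
  assumes "a \<in> R" shows "casimir ** a = a ** casimir"
proof -
  have "bilinear (\<lambda>u v :: complex^'n^'n. adj u ** v)"
    by (simp add: bilinear_def linear_iff adj_add adj_scaleR mult_add_left matrix_add_ldistrib
        scaleR_mult_left scaleR_mult_right)
  from basis_sum_mult[OF this assms] show ?thesis
    by (simp add: casimir_def mult_sum_left mult_sum_right adj_mult matrix_mul_assoc)
qed

text \<open>
  With \<open>D = (\<Sum>r\<in>N. r \<otimes> r)\<close> this is the identity \<open>D\<^sup>2 = D (c \<otimes> 1)\<close>, where \<open>c\<close> is the Casimir element.
\<close>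
lemma basis_sum_product:
  fixes f :: "complex^'n^'n \<Rightarrow> complex^'n^'n \<Rightarrow> 'c::real_vector"
  assumes f: "bilinear f"
  shows "(\<Sum>r\<in>N. \<Sum>s\<in>N. f (r ** s) (r ** s)) = (\<Sum>r\<in>N. f (r ** casimir) r)"
proof -
  have "(\<Sum>r\<in>N. f (r ** s) (r ** s)) = (\<Sum>r\<in>N. f (r ** adj s ** s) r)" if "s \<in> N" for s
    using basis_sum_mult[OF bilinear_mult_left[OF f] N_R[OF that]] .
  hence "(\<Sum>r\<in>N. \<Sum>s\<in>N. f (r ** s) (r ** s)) = (\<Sum>r\<in>N. \<Sum>s\<in>N. f (r ** adj s ** s) r)"
    by (subst sum.swap, subst (2) sum.swap) simp
  also have "\<dots> = (\<Sum>r\<in>N. f (r ** casimir) r)"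
  proof (rule sum.cong[OF refl])
    fix r
    have "linear (\<lambda>u. f u r)" using f by (simp add: bilinear_def)
    from linear_sum[OF this, of "\<lambda>s. r ** adj s ** s" N]
    show "(\<Sum>s\<in>N. f (r ** adj s ** s) r) = f (r ** casimir) r"
      by (simp add: casimir_def mult_sum_right matrix_mul_assoc)
  qed
  finally show ?thesis .
qed

text \<open>
  This is \<open>D (c\<^sup>2 \<otimes> 1) = D (c \<otimes> 1) D\<close>. The right hand side has the middle factor \<open>c = (\<Sum>s\<in>N. s* s)\<close>
  in positive position, which makes the associated maps visibly positive.
\<close>
lemma basis_sum_casimir_square:
  fixes f :: "complex^'n^'n \<Rightarrow> complex^'n^'n \<Rightarrow> 'c::real_vector"
  assumes f: "bilinear f"
  shows "(\<Sum>r\<in>N. f (r ** casimir ** casimir) r)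
    = (\<Sum>s\<in>N. \<Sum>r\<in>N. \<Sum>t\<in>N. f (r ** adj s ** s ** t) (r ** t))"
proof -
  have "(\<Sum>r\<in>N. f (r ** casimir ** casimir) r) = (\<Sum>r\<in>N. \<Sum>t\<in>N. f (r ** t ** casimir) (r ** t))"
    using basis_sum_product[OF bilinear_mult_left[OF f, of casimir]] by simp
  also have "\<dots> = (\<Sum>r\<in>N. \<Sum>t\<in>N. \<Sum>s\<in>N. f (r ** adj s ** s ** t) (r ** t))"
  proof (intro sum.cong refl)
    fix r t assume "t \<in> N"
    have "linear (\<lambda>u. f u (r ** t))" using f by (simp add: bilinear_def)
    from linear_sum[OF this, of "\<lambda>s. r ** adj s ** s ** t" N]
    have "f (\<Sum>s\<in>N. r ** adj s ** s ** t) (r ** t) = (\<Sum>s\<in>N. f (r ** adj s ** s ** t) (r ** t))" .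
    moreover have "(\<Sum>s\<in>N. r ** adj s ** s ** t) = r ** (casimir ** t)"
      by (simp add: casimir_def mult_sum_right mult_sum_left matrix_mul_assoc)
    moreover have "r ** t ** casimir = r ** (casimir ** t)"
      using casimir_commute[OF N_R[OF \<open>t \<in> N\<close>]] by (simp add: matrix_mul_assoc)
    ultimately show "f (r ** t ** casimir) (r ** t) = (\<Sum>s\<in>N. f (r ** adj s ** s ** t) (r ** t))"
      by simp
  qed
  also have "\<dots> = (\<Sum>r\<in>N. \<Sum>s\<in>N. \<Sum>t\<in>N. f (r ** adj s ** s ** t) (r ** t))"
    by (intro sum.cong refl sum.swap)
  also have "\<dots> = (\<Sum>s\<in>N. \<Sum>r\<in>N. \<Sum>t\<in>N. f (r ** adj s ** s ** t) (r ** t))"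
    by (rule sum.swap)
  finally show ?thesis .
qed

lemma casimir_kernel:
  assumes "casimir *v x = 0" shows "e *v x = 0"
proof -
  have "inner ((adj s ** s) *v x) x = inner (s *v x) (s *v x)" for s :: "complex^'n^'n"
    by (simp add: inner_eq_Re_cinner cinner_adj[of "adj s"] flip: matrix_vector_mul_assoc)
  hence "(\<Sum>s\<in>N. inner (s *v x) (s *v x)) = inner (casimir *v x) x"
    by (simp add: casimir_def sum_vector inner_sum_left)
  also have "\<dots> = 0" using assms by simp
  finally have "\<forall>s\<in>N. inner (s *v x) (s *v x) = 0"
    using onb by (subst (asm) sum_nonneg_eq_0_iff) (auto simp: orthonormal_def)
  hence "s *v x = 0" if "s \<in> N" for s using that by simp
  moreover have "linear (\<lambda>a :: complex^'n^'n. a *v x)"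
    by (simp add: linear_iff matrix_vector_mult_add_rdistrib scaleR_vector)
  moreover have "e \<in> span N" using unit_R span_N by simp
  ultimately show ?thesis using linear_eq_0_on_span[of "\<lambda>a. a *v x" N e] by blast
qed

text \<open>
  The unit of \<open>R\<close> may be smaller than the identity matrix, so the matrix that is inverted is
  \<open>c + (1 - e)\<close>, with \<open>c\<close> the Casimir element. It is injective because \<open>inner (c x) x\<close> is the sum of
  the squared lengths of the vectors \<open>s x\<close>, and \<open>e\<close> is a combination of the \<open>s\<close>.
\<close>
lemma casimir_inverse:
  obtains \<kappa> where "adj \<kappa> = \<kappa>" "\<And>a. a \<in> R \<Longrightarrow> \<kappa> ** a = a ** \<kappa>"
    "\<kappa> ** casimir = e" "casimir ** \<kappa> = e"
proof -
  let ?m = "casimir + (mat 1 - e)"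
  have me: "?m ** e = casimir" "e ** ?m = casimir"
    using casimir_R unit_R by (simp_all add: mult_add_left mult_diff_left matrix_add_ldistrib
        mult_diff_right left_unit right_unit)
  have "x = 0" if "?m *v x = 0" for x
  proof -
    have "casimir *v x = 0"
      using that me(2) by (metis matrix_vector_mul_assoc matrix_vector_mult_0_right)
    moreover from casimir_kernel[OF this] have "e *v x = 0" .
    ultimately show ?thesis
      using that by (simp add: matrix_vector_mult_add_rdistrib matrix_vector_mult_diff_rdistrib)
  qed
  hence "\<exists>k. k ** ?m = mat 1"
    by (simp add: matrix_left_invertible_ker)
  then obtain \<kappa> where k: "\<kappa> ** ?m = mat 1" by blast
  hence k': "?m ** \<kappa> = mat 1" by (simp add: matrix_left_right_inverse)
  have "adj \<kappa> ** ?m = mat 1"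
    using arg_cong[OF k', of adj] by (simp add: adj_mult adj_add adj_diff adj_casimir adj_unit)
  hence "adj \<kappa> = \<kappa>" using k' by (metis matrix_mul_assoc matrix_mul_lid matrix_mul_rid)
  moreover have "\<kappa> ** a = a ** \<kappa>" if a: "a \<in> R" for a
  proof -
    have "?m ** a = a ** ?m"
      using casimir_commute[OF a] left_unit[OF a] right_unit[OF a]
      by (simp add: mult_add_left mult_diff_left matrix_add_ldistrib mult_diff_right)
    thus ?thesis using k k' by (metis matrix_mul_assoc matrix_mul_lid matrix_mul_rid)
  qed
  moreover have "\<kappa> ** casimir = e"
    using k me(1) by (metis matrix_mul_assoc matrix_mul_lid)
  moreover have "casimir ** \<kappa> = e"
    using k' me(2) by (metis matrix_mul_assoc matrix_mul_rid)
  ultimately show ?thesis using that by blast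
qed

text \<open>
  The orthogonal projection onto \<open>R\<close> is \<open>x \<mapsto> (\<Sum>r\<in>N. Re (trace (x ** adj r)) r)\<close>, and \<open>cp_part\<close> is its
  complex linear part. Its conjugate linear part, composed with the adjoint, is \<open>cop_part\<close>.
\<close>
definition cp_part :: "complex^'n^'n \<Rightarrow> complex^'n^'n" where
  "cp_part x = (1/2) *\<^sub>R (\<Sum>r\<in>N. cscale (trace (x ** adj r)) r)"

definition cop_part :: "complex^'n^'n \<Rightarrow> complex^'n^'n" where
  "cop_part x = (1/2) *\<^sub>R (\<Sum>r\<in>N. cscale (trace (x ** r)) r)"

lemma parts_additive: "cp_part (x + y) = cp_part x + cp_part y" "cop_part (x + y) = cop_part x + cop_part y"
  by (simp_all add: cp_part_def cop_part_def mult_add_left trace_add cscale_add_left sum.distrib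
      scaleR_add_right)

lemma parts_cscale: "cp_part (cscale c x) = cscale c (cp_part x)" "cop_part (cscale c x) = cscale c (cop_part x)"
  by (simp_all add: cp_part_def cop_part_def cscale_mult_left trace_cscale cscale_sum cscale_scaleR)

text \<open>
  The argument is written as \<open>x = c y c\<close> on the range of \<open>e\<close>, with the central \<open>c\<close>; moving both
  factors \<open>c\<close> to the side of \<open>r\<close> puts the sum into the form of \<open>basis_sum_casimir_square\<close>.
\<close>
lemma kraus_expand:
  assumes kappa: "adj \<kappa> = \<kappa>" "\<And>a. a \<in> R \<Longrightarrow> \<kappa> ** a = a ** \<kappa>"
    "\<kappa> ** casimir = e" "casimir ** \<kappa> = e" and y: "y = \<kappa> ** x ** \<kappa>"
  shows "(\<Sum>r\<in>N. cscale (trace (x ** adj r)) r)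
      = (\<Sum>s\<in>N. \<Sum>r\<in>N. \<Sum>t\<in>N. cscale (trace (y ** (adj t ** adj s ** s ** adj r))) (r ** t))" (is ?cp)
    and "(\<Sum>r\<in>N. cscale (trace (x ** r)) r)
      = (\<Sum>s\<in>N. \<Sum>r\<in>N. \<Sum>t\<in>N. cscale (trace (y ** (r ** adj s ** s ** t))) (r ** t))" (is ?cop)
proof -
  have collapse: "trace (y ** (a ** casimir ** casimir)) = trace (x ** a)" if a: "a \<in> R" for a
  proof -
    have "trace (y ** (a ** casimir ** casimir)) = trace (x ** (\<kappa> ** a ** casimir ** casimir ** \<kappa>))"
      unfolding y by (metis matrix_mul_assoc trace_mul_sym)
    also have "\<kappa> ** a ** casimir ** casimir ** \<kappa> = a ** (\<kappa> ** casimir) ** (casimir ** \<kappa>)"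
      using kappa(2)[OF a] by (simp add: matrix_mul_assoc)
    also have "\<dots> = a" using a by (simp add: kappa right_unit)
    finally show ?thesis .
  qed
  have "bilinear (\<lambda>u v. cscale (trace (y ** adj u)) v)"
    by (simp add: bilinear_def linear_iff adj_add adj_scaleR matrix_add_ldistrib trace_add
        cscale_add cscale_add_left cscale_scaleR scaleR_mult_right)
      (simp add: trace_cscale flip: cscale_of_real)
  note sum = basis_sum_casimir_square[OF this]
  have "adj (r ** casimir ** casimir) = adj r ** casimir ** casimir" if "r \<in> N" for r
    using casimir_commute[OF R_adj[OF N_R[OF that]]]
    by (simp add: adj_mult adj_casimir) (metis matrix_mul_assoc)
  hence "(\<Sum>r\<in>N. cscale (trace (x ** adj r)) r)
      = (\<Sum>r\<in>N. cscale (trace (y ** adj (r ** casimir ** casimir))) r)"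
    using collapse[OF R_adj[OF N_R]] by simp
  with sum show ?cp by (simp add: adj_mult matrix_mul_assoc)
  have "bilinear (\<lambda>u v. cscale (trace (y ** u)) v)"
    by (simp add: bilinear_def linear_iff matrix_add_ldistrib trace_add
        cscale_add cscale_add_left cscale_scaleR scaleR_mult_right)
      (simp add: trace_cscale flip: cscale_of_real)
  from basis_sum_casimir_square[OF this] show ?cop
    using collapse[OF N_R] by simp
qed

end

section \<open>Decomposing a matrix algebra along a real subalgebra\<close>

context orthonormal_star_algebra
begin

text \<open>
  The image of \<open>\<xi>\<close> under a Kraus operator \<open>V\<close>, indexed by \<open>s, p, q\<close>. The completely positive part is half a sum of
  \<open>y \<mapsto> V* y V\<close> over linear \<open>V\<close> (\<open>c = id\<close>), the copositive part over conjugate linear \<open>V\<close> (\<open>c = cnj\<close>).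
\<close>
definition kraus_vector :: "(complex \<Rightarrow> complex) \<Rightarrow> complex^'n^'n \<Rightarrow> 'n \<Rightarrow> 'n \<Rightarrow> complex^'n \<Rightarrow> complex^'n" where
  "kraus_vector c s p q \<xi> = (\<Sum>t\<in>N. c ((t *v \<xi>) $ q) *s (adj t *v (adj s *v axis p 1)))"

text \<open>
  The two vectors in a Kraus form come out as sums over \<open>t\<close> and over \<open>adj r\<close>; the basis sum is invariant
  under the adjoint, so they are built by the same operator.
\<close>
lemma kraus_vector_adj:
  assumes c: "c = id \<or> c = cnj"
  shows "kraus_vector c s p q \<xi> = (\<Sum>r\<in>N. c ((adj r *v \<xi>) $ q) *s (r *v (adj s *v axis p 1)))"
proof -
  have "bilinear (\<lambda>u v :: complex^'n^'n. c ((u *v \<xi>) $ q) *s (v *v (adj s *v axis p 1)))"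
    using c by (auto simp: bilinear_def linear_iff matrix_vector_mult_add_rdistrib scaleR_vector
        vector_sadd_rdistrib vector_add_ldistrib)
      (auto simp: vec_eq_iff complex_eq_iff algebra_simps)
  from basis_sum_adj[OF this] show ?thesis by (simp add: kraus_vector_def)
qed

text \<open>
  The trace is expanded over \<open>p\<close>, the inner product over \<open>q\<close>.
\<close>
lemma kraus_form_cp:
  "(\<Sum>r\<in>N. \<Sum>t\<in>N. trace (y ** (adj t ** adj s ** s ** adj r)) * cinner (t *v \<xi>) (adj r *v \<zeta>))
    = (\<Sum>p\<in>UNIV. \<Sum>q\<in>UNIV. cinner (y *v kraus_vector id s p q \<xi>) (kraus_vector id s p q \<zeta>))" (is "?l = ?r")
proof -
  let ?K = "\<lambda>p r t. cinner (y *v (adj t *v (adj s *v axis p 1))) (r *v (adj s *v axis p 1))"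
  have tr: "trace (y ** (adj t ** adj s ** s ** adj r)) = (\<Sum>p\<in>UNIV. ?K p r t)" for r t
  proof -
    have "trace (y ** (adj t ** adj s ** s ** adj r)) = trace ((s ** adj r) ** (y ** adj t ** adj s))"
      by (subst trace_mul_sym) (simp add: matrix_mul_assoc)
    thus ?thesis
      by (simp add: trace_eq_sum_cinner cinner_adj[of s] cinner_adj[of "adj r"] flip: matrix_vector_mul_assoc)
  qed
  have "?r = (\<Sum>p\<in>UNIV. \<Sum>q\<in>UNIV. \<Sum>r\<in>N. \<Sum>t\<in>N. (t *v \<xi>) $ q * cnj ((adj r *v \<zeta>) $ q) * ?K p r t)"
    unfolding kraus_vector_adj[of id s _ _ \<zeta>, OF disjI1[OF refl]]
    by (simp add: kraus_vector_def vector_sum cinner_sum_left cinner_sum_right vector_scalar_commute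
        cinner_mult_left cinner_mult_right sum_distrib_left mult.assoc mult.left_commute)
  also have "\<dots> = (\<Sum>r\<in>N. \<Sum>t\<in>N. \<Sum>p\<in>UNIV. \<Sum>q\<in>UNIV. (t *v \<xi>) $ q * cnj ((adj r *v \<zeta>) $ q) * ?K p r t)"
    by (simp only: sum.swap[of _ N UNIV])
  also have "\<dots> = ?l"
    by (simp add: tr cinner_def[of "_ *v \<xi>"] sum_distrib_left sum_distrib_right mult.commute)
  finally show ?thesis by simp
qed

lemma kraus_form_cop:
  "(\<Sum>r\<in>N. \<Sum>t\<in>N. trace (y ** (r ** adj s ** s ** t)) * cinner (t *v \<xi>) (adj r *v \<zeta>))
    = (\<Sum>p\<in>UNIV. \<Sum>q\<in>UNIV. cinner (y *v kraus_vector cnj s p q \<zeta>) (kraus_vector cnj s p q \<xi>))" (is "?l = ?r")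
proof -
  let ?K = "\<lambda>p r t. cinner (y *v (r *v (adj s *v axis p 1))) (adj t *v (adj s *v axis p 1))"
  have tr: "trace (y ** (r ** adj s ** s ** t)) = (\<Sum>p\<in>UNIV. ?K p r t)" for r t
  proof -
    have "trace (y ** (r ** adj s ** s ** t)) = trace ((s ** t) ** (y ** r ** adj s))"
      by (subst trace_mul_sym) (simp add: matrix_mul_assoc)
    thus ?thesis
      by (simp add: trace_eq_sum_cinner cinner_adj[of s] cinner_adj[of t] flip: matrix_vector_mul_assoc)
  qed
  have "?r = (\<Sum>p\<in>UNIV. \<Sum>q\<in>UNIV. \<Sum>r\<in>N. \<Sum>t\<in>N. (t *v \<xi>) $ q * cnj ((adj r *v \<zeta>) $ q) * ?K p r t)"
    unfolding kraus_vector_adj[of cnj s _ _ \<zeta>, OF disjI2[OF refl]]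
    by (subst sum.swap[of _ N N])
      (simp add: kraus_vector_def vector_sum cinner_sum_left cinner_sum_right vector_scalar_commute
        cinner_mult_left cinner_mult_right sum_distrib_left mult.assoc mult.left_commute)
  also have "\<dots> = (\<Sum>r\<in>N. \<Sum>t\<in>N. \<Sum>p\<in>UNIV. \<Sum>q\<in>UNIV. (t *v \<xi>) $ q * cnj ((adj r *v \<zeta>) $ q) * ?K p r t)"
    by (simp only: sum.swap[of _ N UNIV])
  also have "\<dots> = ?l"
    by (simp add: tr cinner_def[of "_ *v \<xi>"] sum_distrib_left sum_distrib_right mult.commute)
  finally show ?thesis by simp
qed

lemma positive_block_cp_part:
  assumes a: "positive_block k a"
  shows "positive_block k (\<lambda>i j. cp_part (a i j))"
  unfolding positive_block_def
proof
  fix \<xi> :: "nat \<Rightarrow> complex^'n"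
  obtain \<kappa> where kappa: "adj \<kappa> = \<kappa>" "\<And>a. a \<in> R \<Longrightarrow> \<kappa> ** a = a ** \<kappa>"
    "\<kappa> ** casimir = e" "casimir ** \<kappa> = e" by (rule casimir_inverse) blast
  define y where "y i j = \<kappa> ** a i j ** \<kappa>" for i j
  have y: "positive_block k y"
    using positive_block_conjugate[OF a kappa(1)] by (simp add: y_def[abs_def])
  let ?V = "\<lambda>s p q i. kraus_vector id s p q (\<xi> i)"
  have entry: "cinner (cp_part (a i j) *v \<xi> j) (\<xi> i)
      = (\<Sum>s\<in>N. \<Sum>p\<in>UNIV. \<Sum>q\<in>UNIV. cinner (y i j *v ?V s p q j) (?V s p q i)) / 2" for i j
  proof -
    have "(\<Sum>r\<in>N. cscale (trace (a i j ** adj r)) r)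
        = (\<Sum>s\<in>N. \<Sum>r\<in>N. \<Sum>t\<in>N. cscale (trace (y i j ** (adj t ** adj s ** s ** adj r))) (r ** t))"
      by (rule kraus_expand(1)[OF kappa(1) _ kappa(3,4) y_def]) (rule kappa(2))
    thus ?thesis
      unfolding cp_part_def kraus_form_cp[symmetric]
      by (simp add: scaleR_vector sum_vector cscale_vector cinner_scaleR_left cinner_sum_left
          cinner_mult_left cinner_adj[of r for r] flip: matrix_vector_mul_assoc)
  qed
  have "(\<Sum>i<k. cinner (\<Sum>j<k. cp_part (a i j) *v \<xi> j) (\<xi> i))
      = (\<Sum>i<k. \<Sum>j<k. \<Sum>s\<in>N. \<Sum>p\<in>UNIV. \<Sum>q\<in>UNIV. cinner (y i j *v ?V s p q j) (?V s p q i)) / 2"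
    by (simp add: cinner_sum_left entry sum_divide_distrib)
  also have "\<dots> = (\<Sum>s\<in>N. \<Sum>p\<in>UNIV. \<Sum>q\<in>UNIV. \<Sum>i<k. cinner (\<Sum>j<k. y i j *v ?V s p q j) (?V s p q i)) / 2"
    by (simp only: sum.swap[of _ N "{..<k}"] sum.swap[of _ UNIV "{..<k}"] cinner_sum_left)
  also have "\<dots> \<in> \<real>\<^sub>\<ge>\<^sub>0"
  proof (rule half_nonneg, intro nonneg_Reals_sum[of N] nonneg_Reals_sum[of UNIV])
    show "(\<Sum>i<k. cinner (\<Sum>j<k. y i j *v ?V s p q j) (?V s p q i)) \<in> \<real>\<^sub>\<ge>\<^sub>0" for s p q
      using y unfolding positive_block_def by (rule spec[where x = "?V s p q"])
  qed
  finally show "(\<Sum>i<k. cinner (\<Sum>j<k. cp_part (a i j) *v \<xi> j) (\<xi> i)) \<in> \<real>\<^sub>\<ge>\<^sub>0" .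
qed

lemma positive_block_cop_part:
  assumes a: "positive_block k a"
  shows "positive_block k (\<lambda>i j. cop_part (a j i))"
  unfolding positive_block_def
proof
  fix \<xi> :: "nat \<Rightarrow> complex^'n"
  obtain \<kappa> where kappa: "adj \<kappa> = \<kappa>" "\<And>a. a \<in> R \<Longrightarrow> \<kappa> ** a = a ** \<kappa>"
    "\<kappa> ** casimir = e" "casimir ** \<kappa> = e" by (rule casimir_inverse) blast
  define y where "y i j = \<kappa> ** a i j ** \<kappa>" for i j
  have y: "positive_block k y"
    using positive_block_conjugate[OF a kappa(1)] by (simp add: y_def[abs_def])
  let ?V = "\<lambda>s p q i. kraus_vector cnj s p q (\<xi> i)"
  have entry: "cinner (cop_part (a j i) *v \<xi> j) (\<xi> i)
      = (\<Sum>s\<in>N. \<Sum>p\<in>UNIV. \<Sum>q\<in>UNIV. cinner (y j i *v ?V s p q i) (?V s p q j)) / 2" for i j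
  proof -
    have "(\<Sum>r\<in>N. cscale (trace (a j i ** r)) r)
        = (\<Sum>s\<in>N. \<Sum>r\<in>N. \<Sum>t\<in>N. cscale (trace (y j i ** (r ** adj s ** s ** t))) (r ** t))"
      by (rule kraus_expand(2)[OF kappa(1) _ kappa(3,4) y_def]) (rule kappa(2))
    thus ?thesis
      unfolding cop_part_def kraus_form_cop[symmetric]
      by (simp add: scaleR_vector sum_vector cscale_vector cinner_scaleR_left cinner_sum_left
          cinner_mult_left cinner_adj[of r for r] flip: matrix_vector_mul_assoc)
  qed
  have "(\<Sum>i<k. cinner (\<Sum>j<k. cop_part (a j i) *v \<xi> j) (\<xi> i))
      = (\<Sum>i<k. \<Sum>j<k. \<Sum>s\<in>N. \<Sum>p\<in>UNIV. \<Sum>q\<in>UNIV. cinner (y j i *v ?V s p q i) (?V s p q j)) / 2"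
    by (simp add: cinner_sum_left entry sum_divide_distrib)
  also have "\<dots> = (\<Sum>j<k. \<Sum>i<k. \<Sum>s\<in>N. \<Sum>p\<in>UNIV. \<Sum>q\<in>UNIV. cinner (y j i *v ?V s p q i) (?V s p q j)) / 2"
    by (subst sum.swap) simp
  also have "\<dots> = (\<Sum>s\<in>N. \<Sum>p\<in>UNIV. \<Sum>q\<in>UNIV. \<Sum>i<k. cinner (\<Sum>j<k. y i j *v ?V s p q j) (?V s p q i)) / 2"
    by (simp only: sum.swap[of _ N "{..<k}"] sum.swap[of _ UNIV "{..<k}"] cinner_sum_left)
  also have "\<dots> \<in> \<real>\<^sub>\<ge>\<^sub>0"
  proof (rule half_nonneg, intro nonneg_Reals_sum[of N] nonneg_Reals_sum[of UNIV])
    show "(\<Sum>i<k. cinner (\<Sum>j<k. y i j *v ?V s p q j) (?V s p q i)) \<in> \<real>\<^sub>\<ge>\<^sub>0" for s p q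
      using y unfolding positive_block_def by (rule spec[where x = "?V s p q"])
  qed
  finally show "(\<Sum>i<k. cinner (\<Sum>j<k. cop_part (a j i) *v \<xi> j) (\<xi> i)) \<in> \<real>\<^sub>\<ge>\<^sub>0" .
qed

lemma parts_in_complex_span:
  assumes "\<And>r. r \<in> R \<Longrightarrow> r \<in> B" and B: "cstar_algebra B"
  shows "cp_part x \<in> B" "cop_part x \<in> B"
proof -
  have "subspace B"
    using B unfolding subspace_def cstar_algebra_def by (metis cscale_of_real)
  moreover have "cscale c r \<in> B" if "r \<in> N" for c r
    using assms(1)[OF N_R[OF that]] B by (auto simp: cstar_algebra_def)
  ultimately show "cp_part x \<in> B" "cop_part x \<in> B"
    by (auto simp: cp_part_def cop_part_def intro!: subspace_scale subspace_sum)
qed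

text \<open>
  For self-adjoint \<open>x\<close> the numbers \<open>trace (x ** adj r)\<close> and \<open>trace (x ** r)\<close> are conjugate, so their mean
  is the real coefficient \<open>inner x r\<close>.
\<close>
lemma parts_self_adjoint:
  assumes "adj x = x"
  shows "cp_part x + cop_part x = (\<Sum>r\<in>N. inner x r *\<^sub>R r)"
proof -
  have "(1/2) *\<^sub>R cscale (trace (x ** adj r)) r + (1/2) *\<^sub>R cscale (trace (x ** r)) r = inner x r *\<^sub>R r" for r
  proof -
    have "trace (x ** r) = cnj (trace (x ** adj r))"
      using assms by (simp add: adj_mult trace_mul_sym[of r x] flip: trace_adj)
    thus ?thesis
      by (simp add: inner_eq_Re_trace vec_eq_iff complex_eq_iff algebra_simps)
  qed
  thus ?thesis
    by (simp add: cp_part_def cop_part_def scaleR_sum_right flip: sum.distrib)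
qed

end

context trace_preserving_projection
begin

text \<open>
  By reversibility \<open>r + adj r\<close> is in \<open>A\<close> for all \<open>r\<close> in the real algebra \<open>R\<close> generated by \<open>A\<close>. A
  self-adjoint element orthogonal to \<open>A\<close> is then orthogonal to \<open>R\<close>, so \<open>P\<close> agrees with the orthogonal
  projection onto \<open>R\<close> on the self-adjoint elements.
\<close>
lemma decomposable_if_reversible:
  assumes rev: "reversible A"
  shows "decomposable B B P"
proof -
  let ?W = "{matrix_prod as |as. as \<noteq> [] \<and> set as \<subseteq> A}"
  define R where "R = span ?W"
  have subR: "subspace R" by (simp add: R_def)
  obtain N where N: "pairwise orthogonal N" "\<And>x. x \<in> N \<Longrightarrow> norm x = 1" "independent N" "span N = R"
    by (rule orthonormal_basis_subspace[OF subR]) blast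
  have WB: "?W \<subseteq> B" using matrix_prod_B by blast
  have RB: "R \<subseteq> B" unfolding R_def using WB B_subspace by (rule span_minimal)
  have AR: "A \<subseteq> R"
  proof
    fix a assume "a \<in> A"
    hence "matrix_prod [a] \<in> ?W" by (intro CollectI exI[of _ "[a]"]) auto
    thus "a \<in> R" unfolding R_def by (simp add: span_base)
  qed
  interpret R: orthonormal_star_algebra R N e
  proof
    show "orthonormal N" "span N = R"
      using N independent_imp_finite by (auto simp: orthonormal_def)
    show "e \<in> R" using AR unit_A by blast
    show "e ** a = a" "a ** e = a" if "a \<in> R" for a
      using that RB unit_left unit_right by auto
    show "adj a \<in> R" if "a \<in> R" for a
      using that unfolding R_def
    proof (induction rule: span_induct)
      case base
      show ?case
        by (simp add: subspace_def span_zero span_add span_scale adj_add adj_scaleR)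
    next
      case (step x)
      then obtain as where "as \<noteq> []" "set as \<subseteq> A" "x = matrix_prod as" by blast
      hence "adj x = matrix_prod (rev as)" "rev as \<noteq> []" "set (rev as) \<subseteq> A"
        by (auto simp: adj_matrix_prod)
      hence "adj x \<in> ?W" by blast
      thus ?case by (auto intro: span_base)
    qed
    have W_mult: "x ** y \<in> R" if "x \<in> ?W" "y \<in> ?W" for x y
    proof -
      from that obtain as bs where "as \<noteq> []" "set as \<subseteq> A" "x = matrix_prod as"
        "bs \<noteq> []" "set bs \<subseteq> A" "y = matrix_prod bs" by blast
      hence "x ** y = matrix_prod (as @ bs)" "as @ bs \<noteq> []" "set (as @ bs) \<subseteq> A"
        by (auto simp: matrix_prod_append)
      thus ?thesis unfolding R_def by (intro span_base) blast
    qed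
    have R_W: "x ** y \<in> R" if x: "x \<in> R" and y: "y \<in> ?W" for x y
      using x unfolding R_def
    proof (induction rule: span_induct)
      case base
      show ?case
        using subR by (simp add: subspace_def mult_add_left scaleR_mult_left flip: R_def)
    qed (use W_mult y in \<open>auto simp: R_def\<close>)
    show "x ** y \<in> R" if x: "x \<in> R" and y: "y \<in> R" for x y
      using y unfolding R_def
    proof (induction rule: span_induct)
      case base
      show ?case
        using subR by (simp add: subspace_def matrix_add_ldistrib scaleR_mult_right flip: R_def)
    qed (use R_W x in \<open>auto simp: R_def\<close>)
  qed
  have sym: "r + adj r \<in> A" if "r \<in> R" for r
    using that unfolding R_def
  proof (induction rule: span_induct)
    case base
    have eq: "(x + y) + adj (x + y) = (x + adj x) + (y + adj y)"
      "t *\<^sub>R x + adj (t *\<^sub>R x) = t *\<^sub>R (x + adj x)" for x y t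
      by (simp_all add: adj_add adj_scaleR scaleR_add_right)
    show ?case
      using A_subspace unfolding subspace_def by (simp only: mem_Collect_eq eq adj_zero) simp
  next
    case (step x)
    then obtain as where "as \<noteq> []" "set as \<subseteq> A" "x = matrix_prod as" by blast
    thus ?case using rev by (simp add: reversible_def adj_matrix_prod)
  qed
  have P_sa: "P x = R.cp_part x + R.cop_part x" if x: "x \<in> self_adjoint_part B" for x
  proof -
    have orth: "inner (x - P x) r = 0" if r: "r \<in> R" for r
    proof -
      let ?y = "x - P x"
      have "adj ?y = ?y"
        using x P_self_adjoint[OF x] by (simp add: self_adjoint_part_def adj_diff)
      hence "inner ?y (adj r) = inner ?y r" by (metis inner_adj)
      moreover have "inner ?y (r + adj r) = 0" by (rule P_orthogonal[OF x sym[OF r]])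
      ultimately show ?thesis by (simp add: inner_add_right)
    qed
    have "P x \<in> R" using x AR by (auto simp: A_eq)
    hence "P x = (\<Sum>r\<in>N. inner (P x) r *\<^sub>R r)" by (simp add: R.expand)
    also have "\<dots> = (\<Sum>r\<in>N. inner x r *\<^sub>R r)"
      using orth[OF R.N_R] by (simp add: inner_diff_left)
    also have "\<dots> = R.cp_part x + R.cop_part x"
      using x by (simp add: R.parts_self_adjoint self_adjoint_part_def)
    finally show ?thesis .
  qed
  have P_eq: "P x = R.cp_part x + R.cop_part x" if x: "x \<in> B" for x
  proof -
    obtain b c where bc: "b \<in> self_adjoint_part B" "c \<in> self_adjoint_part B" "x = b + cscale \<i> c"
      using self_adjoint_split[OF x] .
    hence "P x = P b + cscale \<i> (P c)"
      by (simp add: P_add P_cscale B_cscale self_adjoint_part_def)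
    thus ?thesis
      using bc by (simp add: P_sa R.parts_additive R.parts_cscale cscale_add)
  qed
  have lin: "linear_map B B R.cp_part" "linear_map B B R.cop_part"
    using R.parts_in_complex_span[of B] RB cstar
    by (auto simp: linear_map_def R.parts_additive R.parts_cscale)
  have "completely_positive B B R.cp_part"
    using lin R.positive_block_cp_part by (auto simp: completely_positive_def k_positive_def)
  moreover have "copositive B B R.cop_part"
    using lin R.positive_block_cop_part by (auto simp: copositive_def k_copositive_def)
  ultimately show ?thesis
    using projection P_eq unfolding decomposable_def projection_map_def by blast
qed

end

theorem theorem1:
  fixes B A :: "(complex^'n^'n) set"
    and e :: "complex^'n^'n"
    and P :: "complex^'n^'n \<Rightarrow> complex^'n^'n"
  assumes "cstar_algebra B"
    and "is_unit_of e B"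
    and "projection_map B e P"
    and "trace_preserving B P"
    and "A = P ` self_adjoint_part B"
  shows "(two_two_decomposable B B P \<longleftrightarrow> decomposable B B P) \<and>
         (atomic B B P \<longleftrightarrow> nonreversible_jordan_algebra_in B A)"
proof -
  interpret trace_preserving_projection B e P A
    by unfold_locales (use assms in auto)
  have "two_two_decomposable B B P" if "decomposable B B P"
    using that unfolding decomposable_def two_two_decomposable_def
      completely_positive_def copositive_def by blast
  hence "two_two_decomposable B B P \<longleftrightarrow> decomposable B B P"
    and "two_two_decomposable B B P \<longleftrightarrow> reversible A"
    using reversible_if_two_two_decomposable decomposable_if_reversible by blast+
  thus ?thesis
    using A_jordan_algebra projection
    by (auto simp: atomic_def nonreversible_jordan_algebra_in_def projection_map_def)
qed

end
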